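(* If an indiscernible sequence $(\bar a_i)_{i\in I}$ has a canonical base, then the canonical base is interdefinable with $\ker(\bar a_i)_{i\in I}$ (i.e. the two sets have the same definable closure).
   Context: $T$ is a complete consistent first-order theory (possibly many-sorted); we work in a big saturated model of $T$, with definable closure $\operatorname{dcl}$. Tuples may be infinite. Sequences of indiscernibles are indexed by arbitrary infinite (small) linearly ordered sets; sets of parameters are small. The kernel of a sequence of indiscernibles $(\bar a_i)_{i\in I}$ is the set $$\ker(\bar a_i)_{i\in I}=\{d\mid d\in\operatorname{dcl}(\{\bar a_i\mid i\in I\})\text{ and }(\bar a_i)_{i\in I}\text{ is indiscernible over }d\}.$$ Two sequences of indiscernibles $(\bar a_i)_{i\in I}$ and $(\bar b_j)_{j\in J}$ are cleanly collinear if one of their two concatenations (indexed by the disjoint union $I+J$ with $I<J$, or by $J+I$ with $J<I$) is indiscernible. $\approx$ denotes the transitive closure of clean collinearity. A sequence of indiscernibles $(\bar a_i)_{i\in I}$ is based on a set $B$ if every automorphism $\sigma$ of the big model that fixes $B$ pointwise satisfies $(\sigma(\bar a_i))_{i\in I}\approx(\bar a_i)_{i\in I}$. The set $B$ is a canonical base for $(\bar a_i)_{i\in I}$ if the converse is also true, i.e. if for every automorphism $\sigma$ of the big model: $\sigma$ fixes $B$ pointwise if and only if $(\sigma(\bar a_i))_{i\in I}\approx(\bar a_i)_{i\in I}$. *)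

theory Defs
  imports Main
begin

unbundle cardinal_syntax

section \<open>Many-sorted first-order logic\<close>

record ('s, 'f, 'r) signature =
  sorts :: "'s set"
  funs :: "'f set"
  rels :: "'r set"
  fun_args :: "'f \<Rightarrow> 's list"
  fun_res :: "'f \<Rightarrow> 's"
  rel_args :: "'r \<Rightarrow> 's list"

definition wf_signature :: "('s, 'f, 'r) signature \<Rightarrow> bool" where
  "wf_signature L \<longleftrightarrow>
     (\<forall>f\<in>funs L. set (fun_args L f) \<subseteq> sorts L \<and> fun_res L f \<in> sorts L) \<and>
     (\<forall>R\<in>rels L. set (rel_args L R) \<subseteq> sorts L)"

text \<open>A variable \<open>(n, s)\<close> is the \<open>n\<close>-th variable of sort \<open>s\<close>.\<close>

type_synonym 's var = "nat \<times> 's"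

datatype ('s, 'f) tm = Var "'s var" | App 'f "('s, 'f) tm list"

datatype ('s, 'f, 'r) fm =
    Falsum
  | Equal "('s, 'f) tm" "('s, 'f) tm"
  | Pred 'r "('s, 'f) tm list"
  | Imp "('s, 'f, 'r) fm" "('s, 'f, 'r) fm"
  | All "'s var" "('s, 'f, 'r) fm"

primrec tm_sort :: "('s, 'f, 'r) signature \<Rightarrow> ('s, 'f) tm \<Rightarrow> 's" where
  "tm_sort L (Var v) = snd v"
| "tm_sort L (App f ts) = fun_res L f"

fun wf_tm :: "('s, 'f, 'r) signature \<Rightarrow> ('s, 'f) tm \<Rightarrow> bool" where
  "wf_tm L (Var v) \<longleftrightarrow> snd v \<in> sorts L"
| "wf_tm L (App f ts) \<longleftrightarrow>
     f \<in> funs L \<and> map (tm_sort L) ts = fun_args L f \<and> (\<forall>t\<in>set ts. wf_tm L t)"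

primrec wf_fm :: "('s, 'f, 'r) signature \<Rightarrow> ('s, 'f, 'r) fm \<Rightarrow> bool" where
  "wf_fm L Falsum \<longleftrightarrow> True"
| "wf_fm L (Equal t u) \<longleftrightarrow> wf_tm L t \<and> wf_tm L u \<and> tm_sort L t = tm_sort L u"
| "wf_fm L (Pred R ts) \<longleftrightarrow>
     R \<in> rels L \<and> map (tm_sort L) ts = rel_args L R \<and> (\<forall>t\<in>set ts. wf_tm L t)"
| "wf_fm L (Imp p q) \<longleftrightarrow> wf_fm L p \<and> wf_fm L q"
| "wf_fm L (All v p) \<longleftrightarrow> snd v \<in> sorts L \<and> wf_fm L p"

definition formulas :: "('s, 'f, 'r) signature \<Rightarrow> ('s, 'f, 'r) fm set" where
  "formulas L = {p. wf_fm L p}"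

primrec tm_vars :: "('s, 'f) tm \<Rightarrow> 's var set" where
  "tm_vars (Var v) = {v}"
| "tm_vars (App f ts) = \<Union> (set (map tm_vars ts))"

primrec free_vars :: "('s, 'f, 'r) fm \<Rightarrow> 's var set" where
  "free_vars Falsum = {}"
| "free_vars (Equal t u) = tm_vars t \<union> tm_vars u"
| "free_vars (Pred R ts) = \<Union> (tm_vars ` set ts)"
| "free_vars (Imp p q) = free_vars p \<union> free_vars q"
| "free_vars (All v p) = free_vars p - {v}"

definition sentences :: "('s, 'f, 'r) signature \<Rightarrow> ('s, 'f, 'r) fm set" where
  "sentences L = {p \<in> formulas L. free_vars p = {}}"

record ('s, 'f, 'r, 'a) struct =
  sort_dom :: "'s \<Rightarrow> 'a set"
  fun_int :: "'f \<Rightarrow> 'a list \<Rightarrow> 'a"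
  rel_int :: "'r \<Rightarrow> 'a list \<Rightarrow> bool"

definition univ :: "('s, 'f, 'r) signature \<Rightarrow> ('s, 'f, 'r, 'a) struct \<Rightarrow> 'a set" where
  "univ L M = (\<Union>s\<in>sorts L. sort_dom M s)"

text \<open>The sorts are taken to be disjoint, so that an element determines its sort and a map
  of the whole universe can represent a family of maps indexed by the sorts.\<close>

definition wf_struct :: "('s, 'f, 'r) signature \<Rightarrow> ('s, 'f, 'r, 'a) struct \<Rightarrow> bool" where
  "wf_struct L M \<longleftrightarrow>
     (\<forall>s\<in>sorts L. sort_dom M s \<noteq> {}) \<and>
     (\<forall>s\<in>sorts L. \<forall>t\<in>sorts L. s \<noteq> t \<longrightarrow> sort_dom M s \<inter> sort_dom M t = {}) \<and>
     (\<forall>f\<in>funs L. \<forall>xs. list_all2 (\<lambda>x s. x \<in> sort_dom M s) xs (fun_args L f) \<longrightarrow>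
        fun_int M f xs \<in> sort_dom M (fun_res L f))"

primrec tm_val :: "('s, 'f, 'r, 'a) struct \<Rightarrow> ('s var \<Rightarrow> 'a) \<Rightarrow> ('s, 'f) tm \<Rightarrow> 'a" where
  "tm_val M e (Var v) = e v"
| "tm_val M e (App f ts) = fun_int M f (map (tm_val M e) ts)"

primrec sat :: "('s, 'f, 'r, 'a) struct \<Rightarrow> ('s var \<Rightarrow> 'a) \<Rightarrow> ('s, 'f, 'r) fm \<Rightarrow> bool" where
  "sat M e Falsum \<longleftrightarrow> False"
| "sat M e (Equal t u) \<longleftrightarrow> tm_val M e t = tm_val M e u"
| "sat M e (Pred R ts) \<longleftrightarrow> rel_int M R (map (tm_val M e) ts)"
| "sat M e (Imp p q) \<longleftrightarrow> (sat M e p \<longrightarrow> sat M e q)"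
| "sat M e (All v p) \<longleftrightarrow> (\<forall>d\<in>sort_dom M (snd v). sat M (e(v := d)) p)"

definition valid_in :: "('s, 'f, 'r, 'a) struct \<Rightarrow> ('s, 'f, 'r) fm \<Rightarrow> bool" where
  "valid_in M p \<longleftrightarrow> (\<forall>e. sat M e p)"

definition models ::
  "('s, 'f, 'r) signature \<Rightarrow> ('s, 'f, 'r) fm set \<Rightarrow> ('s, 'f, 'r, 'a) struct set" where
  "models L T = {M. wf_struct L M \<and> (\<forall>p\<in>T. valid_in M p)}"

text \<open>Consistency and completeness, expressed by models whose elements come from a type
  \<open>'u\<close>. By the Loewenheim-Skolem theorem this is the usual notion as soon as \<open>'u\<close> has at least
  as many elements as there are formulas.\<close>

definition consistent_theory ::
  "'u itself \<Rightarrow> ('s, 'f, 'r) signature \<Rightarrow> ('s, 'f, 'r) fm set \<Rightarrow> bool" where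
  "consistent_theory _ L T \<longleftrightarrow> T \<subseteq> sentences L \<and> (models L T :: ('s, 'f, 'r, 'u) struct set) \<noteq> {}"

definition complete_theory ::
  "'u itself \<Rightarrow> ('s, 'f, 'r) signature \<Rightarrow> ('s, 'f, 'r) fm set \<Rightarrow> bool" where
  "complete_theory _ L T \<longleftrightarrow> T \<subseteq> sentences L \<and>
     (\<forall>p\<in>sentences L.
        (\<forall>N\<in>(models L T :: ('s, 'f, 'r, 'u) struct set). valid_in N p) \<or>
        (\<forall>N\<in>(models L T :: ('s, 'f, 'r, 'u) struct set). valid_in N (Imp p Falsum)))"

section \<open>The big saturated model\<close>

text \<open>A formula in the variable \<open>v\<close> with parameters in \<open>A\<close> is given by a formula \<open>p\<close> and a
  valuation \<open>e\<close> that replaces the free variables other than \<open>v\<close> by elements of \<open>A\<close>.\<close>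

definition param_formulas :: "('s, 'f, 'r) signature \<Rightarrow> ('s, 'f, 'r, 'a) struct \<Rightarrow>
    's var \<Rightarrow> 'a set \<Rightarrow> (('s, 'f, 'r) fm \<times> ('s var \<Rightarrow> 'a)) set" where
  "param_formulas L M v A =
     {(p, e). p \<in> formulas L \<and> (\<forall>u \<in> free_vars p - {v}. e u \<in> A \<inter> sort_dom M (snd u))}"

definition solutions :: "('s, 'f, 'r, 'a) struct \<Rightarrow> 's var \<Rightarrow>
    (('s, 'f, 'r) fm \<times> ('s var \<Rightarrow> 'a)) \<Rightarrow> 'a set" where
  "solutions M v = (\<lambda>(p, e). {d \<in> sort_dom M (snd v). sat M (e(v := d)) p})"

definition dcl :: "('s, 'f, 'r) signature \<Rightarrow> ('s, 'f, 'r, 'a) struct \<Rightarrow> 'a set \<Rightarrow> 'a set" where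
  "dcl L M A = {d. \<exists>v pe. snd v \<in> sorts L \<and> pe \<in> param_formulas L M v A \<and> solutions M v pe = {d}}"

definition small :: "'k rel \<Rightarrow> 'b set \<Rightarrow> bool" where
  "small \<kappa> A \<longleftrightarrow> |A| <o \<kappa>"

text \<open>Partial types may be used instead of complete ones; finite satisfiability in \<open>M\<close> itself is
  consistency with the elementary diagram of \<open>M\<close>.\<close>

definition saturated_in ::
  "'k rel \<Rightarrow> ('s, 'f, 'r) signature \<Rightarrow> ('s, 'f, 'r, 'a) struct \<Rightarrow> bool" where
  "saturated_in \<kappa> L M \<longleftrightarrow>
     (\<forall>A v \<Sigma>. A \<subseteq> univ L M \<longrightarrow> small \<kappa> A \<longrightarrow> snd v \<in> sorts L \<longrightarrow> \<Sigma> \<subseteq> param_formulas L M v A \<longrightarrow>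
        (\<forall>\<Sigma>\<^sub>0. finite \<Sigma>\<^sub>0 \<longrightarrow> \<Sigma>\<^sub>0 \<subseteq> \<Sigma> \<longrightarrow> (\<exists>d\<in>sort_dom M (snd v). \<forall>pe\<in>\<Sigma>\<^sub>0. d \<in> solutions M v pe)) \<longrightarrow>
        (\<exists>d\<in>sort_dom M (snd v). \<forall>pe\<in>\<Sigma>. d \<in> solutions M v pe))"

text \<open>The cardinal \<open>\<kappa>\<close> is the size of the big model, and exceeds the (always infinite) number
  of formulas. Saturation makes every infinite sort have at least \<open>\<kappa>\<close> elements, so the
  universe has exactly \<open>\<kappa>\<close> elements as soon as one sort is infinite; the inequality
  \<open>|univ L M| \<le>o \<kappa>\<close> merely keeps theories all of whose sorts are finite.\<close>

definition big_saturated_model ::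
  "'k rel \<Rightarrow> ('s, 'f, 'r) signature \<Rightarrow> ('s, 'f, 'r, 'a) struct \<Rightarrow> bool" where
  "big_saturated_model \<kappa> L M \<longleftrightarrow>
     wf_struct L M \<and> Card_order \<kappa> \<and> |formulas L| <o \<kappa> \<and> |univ L M| \<le>o \<kappa> \<and> saturated_in \<kappa> L M"

definition automorphism ::
  "('s, 'f, 'r) signature \<Rightarrow> ('s, 'f, 'r, 'a) struct \<Rightarrow> ('a \<Rightarrow> 'a) \<Rightarrow> bool" where
  "automorphism L M \<sigma> \<longleftrightarrow>
     (\<forall>s\<in>sorts L. bij_betw \<sigma> (sort_dom M s) (sort_dom M s)) \<and>
     (\<forall>f\<in>funs L. \<forall>xs. list_all2 (\<lambda>x s. x \<in> sort_dom M s) xs (fun_args L f) \<longrightarrow>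
        \<sigma> (fun_int M f xs) = fun_int M f (map \<sigma> xs)) \<and>
     (\<forall>R\<in>rels L. \<forall>xs. list_all2 (\<lambda>x s. x \<in> sort_dom M s) xs (rel_args L R) \<longrightarrow>
        (rel_int M R xs \<longleftrightarrow> rel_int M R (map \<sigma> xs)))"

section \<open>Sequences of indiscernibles\<close>

text \<open>The type over \<open>C\<close> of a possibly infinite tuple \<open>(f y)\<close>, \<open>y \<in> Y\<close>. A member \<open>(p, h)\<close> stands
  for the formula \<open>p\<close> in which the free variable \<open>u\<close> has been replaced by the type variable
  \<open>y\<close> if \<open>h u = Inl y\<close>, and by the parameter \<open>c\<close> if \<open>h u = Inr c\<close>. Since membership requires
  the sorts to match, tuples with the same type agree in the sorts of their components.\<close>

definition tp :: "('s, 'f, 'r) signature \<Rightarrow> ('s, 'f, 'r, 'a) struct \<Rightarrow> 'a set \<Rightarrow> 'y set \<Rightarrow>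
    ('y \<Rightarrow> 'a) \<Rightarrow> (('s, 'f, 'r) fm \<times> ('s var \<Rightarrow> 'y + 'a)) set" where
  "tp L M C Y f =
     {(p, h). p \<in> formulas L \<and>
        (\<forall>u\<in>free_vars p. h u \<in> Y <+> C \<and> case_sum f id (h u) \<in> sort_dom M (snd u)) \<and>
        sat M (case_sum f id \<circ> h) p}"

definition increasing :: "'i rel \<Rightarrow> 'i list \<Rightarrow> bool" where
  "increasing r is \<longleftrightarrow> set is \<subseteq> Field r \<and> sorted_wrt (\<lambda>i j. (i, j) \<in> r \<and> i \<noteq> j) is"

text \<open>A sequence is given by its reflexive index order \<open>r\<close>, whose field is the index set, and a
  family \<open>a\<close>; the set \<open>X\<close> indexes the components of the tuples \<open>a i\<close>. Values of \<open>a\<close> outside of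
  \<open>Field r\<close> and \<open>X\<close> do not matter.\<close>

definition indiscernible_over :: "('s, 'f, 'r) signature \<Rightarrow> ('s, 'f, 'r, 'a) struct \<Rightarrow> 'x set \<Rightarrow>
    'a set \<Rightarrow> 'i rel \<Rightarrow> ('i \<Rightarrow> 'x \<Rightarrow> 'a) \<Rightarrow> bool" where
  "indiscernible_over L M X C r a \<longleftrightarrow>
     Linear_order r \<and> infinite (Field r) \<and> (\<forall>i\<in>Field r. \<forall>x\<in>X. a i x \<in> univ L M) \<and>
     (\<forall>is js. increasing r is \<longrightarrow> increasing r js \<longrightarrow> length is = length js \<longrightarrow>
        tp L M C ({..<length is} \<times> X) (\<lambda>(k, x). a (is ! k) x) =
        tp L M C ({..<length js} \<times> X) (\<lambda>(k, x). a (js ! k) x))"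

definition ker :: "('s, 'f, 'r) signature \<Rightarrow> ('s, 'f, 'r, 'a) struct \<Rightarrow> 'x set \<Rightarrow>
    'i rel \<Rightarrow> ('i \<Rightarrow> 'x \<Rightarrow> 'a) \<Rightarrow> 'a set" where
  "ker L M X r a =
     {d. d \<in> dcl L M (\<Union>i\<in>Field r. a i ` X) \<and> indiscernible_over L M X {d} r a}"

definition order_sum :: "'i rel \<Rightarrow> 'j rel \<Rightarrow> ('i + 'j) rel" where
  "order_sum r s = {(Inl i, Inl i') | i i'. (i, i') \<in> r} \<union> {(Inr j, Inr j') | j j'. (j, j') \<in> s} \<union>
     {(Inl i, Inr j) | i j. i \<in> Field r \<and> j \<in> Field s}"

definition cleanly_collinear :: "('s, 'f, 'r) signature \<Rightarrow> ('s, 'f, 'r, 'a) struct \<Rightarrow> 'x set \<Rightarrow>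
    'i rel \<times> ('i \<Rightarrow> 'x \<Rightarrow> 'a) \<Rightarrow> 'j rel \<times> ('j \<Rightarrow> 'x \<Rightarrow> 'a) \<Rightarrow> bool" where
  "cleanly_collinear L M X = (\<lambda>(r, a) (s, b).
     indiscernible_over L M X {} r a \<and> indiscernible_over L M X {} s b \<and>
     (indiscernible_over L M X {} (order_sum r s) (case_sum a b) \<or>
      indiscernible_over L M X {} (order_sum s r) (case_sum b a)))"

text \<open>The transitive closure of clean collinearity, with intermediate sequences indexed by
  arbitrary small linear orders. Indexing by subsets of the type \<open>'k\<close> that carries \<open>\<kappa>\<close> is
  no restriction, as every small linear order has an isomorphic copy there.\<close>

definition collinear :: "'k rel \<Rightarrow> ('s, 'f, 'r) signature \<Rightarrow> ('s, 'f, 'r, 'a) struct \<Rightarrow> 'x set \<Rightarrow>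
    'k rel \<times> ('k \<Rightarrow> 'x \<Rightarrow> 'a) \<Rightarrow> 'k rel \<times> ('k \<Rightarrow> 'x \<Rightarrow> 'a) \<Rightarrow> bool" where
  "collinear \<kappa> L M X =
     (\<lambda>A B. small \<kappa> (Field (fst A)) \<and> small \<kappa> (Field (fst B)) \<and> cleanly_collinear L M X A B)\<^sup>+\<^sup>+"

definition canonical_base :: "'k rel \<Rightarrow> ('s, 'f, 'r) signature \<Rightarrow> ('s, 'f, 'r, 'a) struct \<Rightarrow>
    'x set \<Rightarrow> 'k rel \<Rightarrow> ('k \<Rightarrow> 'x \<Rightarrow> 'a) \<Rightarrow> 'a set \<Rightarrow> bool" where
  "canonical_base \<kappa> L M X r a B \<longleftrightarrow>
     B \<subseteq> univ L M \<and> small \<kappa> B \<and>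
     (\<forall>\<sigma>. automorphism L M \<sigma> \<longrightarrow>
        ((\<forall>b\<in>B. \<sigma> b = b) \<longleftrightarrow> collinear \<kappa> L M X (r, \<lambda>i x. \<sigma> (a i x)) (r, a)))"

end

theory Submission
  imports Defs
begin

text \<open>Let \<open>B\<close> be a canonical base of \<open>a\<close>. By saturation \<open>a\<close> has a continuation \<open>b\<close> such that \<open>a + b\<close> is
  indiscernible. An automorphism \<open>\<sigma>\<close> that fixes \<open>b\<close> satisfies \<open>\<sigma>(a) \<approx> b \<approx> a\<close>, hence fixes \<open>B\<close>. Any
  two increasing tuples of \<open>a\<close> of the same length are conjugate over \<open>b\<close>, so \<open>a\<close> is indiscernible
  over \<open>B\<close>; similarly an automorphism that fixes \<open>a\<close> fixes \<open>B\<close>, so \<open>B \<subseteq> dcl(a)\<close>. Conversely, if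
  \<open>d\<close> is in the kernel, then a formula that defines \<open>d\<close> over some increasing tuple of \<open>a\<close> defines it
  over all of them, and this property passes to every sequence collinear with \<open>a\<close>. If \<open>\<sigma>\<close> fixes \<open>B\<close>,
  then \<open>\<sigma>(a) \<approx> a\<close>, so this formula defines both \<open>d\<close> and \<open>\<sigma>(d)\<close> over \<open>a\<close>. As the big model is
  homogeneous, the elements fixed by all automorphisms over the small set \<open>B\<close> form \<open>dcl(B)\<close>.\<close>

section \<open>Renaming of variables\<close>

text \<open>Saturation is given for one variable at a time, whereas homogeneity and the continuation
  \<open>b\<close> ask for many elements at once. Both come from the same device:
  \<open>realize_one\<close> adds one element to a partial realization of size less than
  \<open>\<kappa>\<close>, and \<open>transfinite_solution\<close> iterates such steps along a
  well-order whose proper initial segments have size less than \<open>\<kappa>\<close>. For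
  homogeneity the type variables are labelled by the elements of the universe; for \<open>b\<close>
  they are labelled by pairs of an index in \<open>order_sum r r\<close> and a component, and
  \<open>a\<close> itself realizes each finite part, since finite parts of
  \<open>order_sum r r\<close> embed into \<open>r\<close>.

  A sequence collinear with \<open>a\<close> is not known to be indiscernible over \<open>d\<close>,
  so that \<open>p\<close> defines \<open>d\<close> cannot be passed on as a formula with parameter
  \<open>d\<close>. What is passed on is that \<open>p\<close> has the same solutions over two
  parameter tuples, a formula in which \<open>d\<close> does not occur.

  Formulas with parameters are pairs of a formula and a valuation. Before two of them are combined,
  their variables must be renamed apart, and variables that carry the same new label must be
  identified.\<close>

primrec ren_tm :: "('s var \<Rightarrow> 's var) \<Rightarrow> ('s, 'f) tm \<Rightarrow> ('s, 'f) tm" where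
  "ren_tm \<rho> (Var v) = Var (\<rho> v)"
| "ren_tm \<rho> (App f ts) = App f (map (ren_tm \<rho>) ts)"

text \<open>Bound variables are renamed together with the free ones; for an injective
  \<open>\<rho>\<close> nothing can then be captured.\<close>

primrec ren_fm :: "('s var \<Rightarrow> 's var) \<Rightarrow> ('s, 'f, 'r) fm \<Rightarrow> ('s, 'f, 'r) fm" where
  "ren_fm \<rho> Falsum = Falsum"
| "ren_fm \<rho> (Equal t u) = Equal (ren_tm \<rho> t) (ren_tm \<rho> u)"
| "ren_fm \<rho> (Pred R ts) = Pred R (map (ren_tm \<rho>) ts)"
| "ren_fm \<rho> (Imp p q) = Imp (ren_fm \<rho> p) (ren_fm \<rho> q)"
| "ren_fm \<rho> (All v p) = All (\<rho> v) (ren_fm \<rho> p)"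

lemma tm_val_ren: "tm_val M e (ren_tm \<rho> t) = tm_val M (e \<circ> \<rho>) t"
  by (induction t) (auto cong: map_cong)

lemma tm_vars_ren: "tm_vars (ren_tm \<rho> t) = \<rho> ` tm_vars t"
  by (induction t) auto

lemma tm_sort_ren:
  assumes "\<And>v. snd (\<rho> v) = snd v"
  shows "tm_sort L (ren_tm \<rho> t) = tm_sort L t"
  using assms by (cases t) auto

lemma wf_tm_ren:
  assumes "\<And>v. snd (\<rho> v) = snd v"
  shows "wf_tm L (ren_tm \<rho> t) = wf_tm L t"
  by (induction t) (auto simp: assms tm_sort_ren comp_def)

lemma sat_ren:
  assumes "inj \<rho>" "\<And>v. snd (\<rho> v) = snd v"
  shows "sat M e (ren_fm \<rho> p) = sat M (e \<circ> \<rho>) p"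
proof (induction p arbitrary: e)
  case (Pred R ts)
  have "map (tm_val M e) (map (ren_tm \<rho>) ts) = map (tm_val M (e \<circ> \<rho>)) ts"
    by (simp add: tm_val_ren)
  then show ?case by (simp only: ren_fm.simps sat.simps)
next
  case (All v p)
  \<comment> \<open>Injectivity enters here: the update at \<open>\<rho> v\<close> reaches no
    renamed variable other than that of \<open>v\<close>.\<close>
  have "e(\<rho> v := d) \<circ> \<rho> = (e \<circ> \<rho>)(v := d)" for d
    using assms(1) by (auto simp: fun_eq_iff inj_eq)
  then show ?case
    by (simp only: ren_fm.simps sat.simps All assms(2))
qed (auto simp: tm_val_ren)

lemma free_vars_ren:
  assumes "inj \<rho>"
  shows "free_vars (ren_fm \<rho> p) = \<rho> ` free_vars p"
  by (induction p) (auto simp: tm_vars_ren inj_eq[OF assms])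

lemma ren_formulas:
  assumes "\<And>v. snd (\<rho> v) = snd v" "p \<in> formulas L"
  shows "ren_fm \<rho> p \<in> formulas L"
  using assms(2) unfolding formulas_def
  by (induction p) (auto simp: assms(1) tm_sort_ren wf_tm_ren comp_def)

lemma tm_val_cong: "(\<And>u. u \<in> tm_vars t \<Longrightarrow> e u = e' u) \<Longrightarrow> tm_val M e t = tm_val M e' t"
proof (induction t)
  case (App f ts)
  then have "map (tm_val M e) ts = map (tm_val M e') ts" by auto
  then show ?case by (metis tm_val.simps(2))
qed simp

lemma sat_cong: "(\<And>u. u \<in> free_vars p \<Longrightarrow> e u = e' u) \<Longrightarrow> sat M e p = sat M e' p"
proof (induction p arbitrary: e e')
  case (Equal t u)
  then have "tm_val M e t = tm_val M e' t" "tm_val M e u = tm_val M e' u"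
    by (auto intro!: tm_val_cong)
  then show ?case by simp
next
  case (Pred R ts)
  have "map (tm_val M e) ts = map (tm_val M e') ts"
    using Pred by (auto intro!: tm_val_cong)
  then show ?case by (metis sat.simps(3))
next
  case (Imp p q)
  have "sat M e p = sat M e' p" "sat M e q = sat M e' q"
    using Imp.prems by (auto intro!: Imp.IH)
  then show ?case by simp
next
  case (All v p)
  have "sat M (e(v := d)) p = sat M (e'(v := d)) p" for d
    using All.prems by (intro All.IH) auto
  then show ?case by simp
qed simp

lemma finite_tm_vars: "finite (tm_vars t)"
  by (induction t) auto

lemma finite_free_vars: "finite (free_vars p)"
  by (induction p) (auto simp: finite_tm_vars)

lemma wf_tm_var_sort: "wf_tm L t \<Longrightarrow> u \<in> tm_vars t \<Longrightarrow> snd u \<in> sorts L"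
  by (induction t) auto

lemma free_var_sort: "p \<in> formulas L \<Longrightarrow> u \<in> free_vars p \<Longrightarrow> snd u \<in> sorts L"
  unfolding formulas_def by (induction p) (auto dest: wf_tm_var_sort)

section \<open>Connectives, and formulas with separate parameters combined into one\<close>

abbreviation Neg :: "('s, 'f, 'r) fm \<Rightarrow> ('s, 'f, 'r) fm" where
  "Neg p \<equiv> Imp p Falsum"

abbreviation Conj :: "('s, 'f, 'r) fm \<Rightarrow> ('s, 'f, 'r) fm \<Rightarrow> ('s, 'f, 'r) fm" where
  "Conj p q \<equiv> Neg (Imp p (Neg q))"

abbreviation Iff :: "('s, 'f, 'r) fm \<Rightarrow> ('s, 'f, 'r) fm \<Rightarrow> ('s, 'f, 'r) fm" where
  "Iff p q \<equiv> Conj (Imp p q) (Imp q p)"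

abbreviation Ex_fm :: "'s var \<Rightarrow> ('s, 'f, 'r) fm \<Rightarrow> ('s, 'f, 'r) fm" where
  "Ex_fm v p \<equiv> Neg (All v (Neg p))"

lemma formulas_simps [simp]:
  "Falsum \<in> formulas L"
  "Imp p q \<in> formulas L \<longleftrightarrow> p \<in> formulas L \<and> q \<in> formulas L"
  "All v p \<in> formulas L \<longleftrightarrow> snd v \<in> sorts L \<and> p \<in> formulas L"
  "Equal (Var u) (Var w) \<in> formulas L \<longleftrightarrow> snd u \<in> sorts L \<and> snd u = snd w"
  by (auto simp: formulas_def)

text \<open>To combine two formulas with their own valuations, all variables except a common \<open>v\<close>
  are renamed apart; \<open>join_val\<close> is the valuation that restricts to both.\<close>

definition apart :: "'s var \<Rightarrow> nat \<Rightarrow> 's var \<Rightarrow> 's var" where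
  "apart v i u = (if u = v then v else (Suc (fst v + 2 * fst u + i), snd u))"

text \<open>Counted from \<open>Suc (fst v)\<close>, the variables of the first formula occupy the
  even places and those of the second the odd ones, so halving recovers the original number. The
  value at \<open>v\<close> is immaterial: in every use \<open>v\<close> is either updated or not
  free.\<close>

definition join_val :: "'s var \<Rightarrow> ('s var \<Rightarrow> 'b) \<Rightarrow> ('s var \<Rightarrow> 'b) \<Rightarrow> 's var \<Rightarrow> 'b" where
  "join_val v e e' u =
     (let m = fst u - Suc (fst v); w = (m div 2, snd u) in if even m then e w else e' w)"

lemma inj_apart: "inj (apart v i)"
  by (rule injI) (auto simp: apart_def prod_eq_iff split: if_splits)

lemma snd_apart [simp]: "snd (apart v i u) = snd u"
  by (simp add: apart_def)

lemma apart_eq_iff [simp]: "apart v i u = v \<longleftrightarrow> u = v" "v = apart v i u \<longleftrightarrow> u = v"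
proof -
  show *: "apart v i u = v \<longleftrightarrow> u = v"
    by (cases v) (auto simp: apart_def)
  show "v = apart v i u \<longleftrightarrow> u = v"
    using * by (metis (no_types))
qed

lemma join_val_apart:
  assumes "u \<noteq> v"
  shows "join_val v e e' (apart v 0 u) = e u" "join_val v e e' (apart v (Suc 0) u) = e' u"
  using assms by (auto simp: join_val_def apart_def Let_def)

lemma comp_join_val: "g \<circ> join_val v e e' = join_val v (g \<circ> e) (g \<circ> e')"
  by (auto simp: join_val_def Let_def fun_eq_iff)

lemma join_val_upd_apart:
  "(join_val v e e')(v := d) \<circ> apart v 0 = e(v := d)"
  "(join_val v e e')(v := d) \<circ> apart v (Suc 0) = e'(v := d)"
  by (auto simp: fun_eq_iff join_val_apart)

abbreviation conj_apart where
  "conj_apart v p q \<equiv> Conj (ren_fm (apart v 0) p) (ren_fm (apart v (Suc 0)) q)"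

abbreviation same_solutions where
  "same_solutions v p q \<equiv> All v (Iff (ren_fm (apart v 0) p) (ren_fm (apart v (Suc 0)) q))"

lemma sat_apart:
  "sat M ((join_val v e e')(v := d)) (ren_fm (apart v 0) p) = sat M (e(v := d)) p"
  "sat M ((join_val v e e')(v := d)) (ren_fm (apart v (Suc 0)) p) = sat M (e'(v := d)) p"
  by (simp_all only: sat_ren[OF inj_apart snd_apart] join_val_upd_apart)

lemma sat_conj_apart:
  "sat M ((join_val v e e')(v := d)) (conj_apart v p q) \<longleftrightarrow>
     sat M (e(v := d)) p \<and> sat M (e'(v := d)) q"
  by (simp add: sat_apart)

lemma sat_same_solutions:
  "sat M (join_val v e e') (same_solutions v p q) \<longleftrightarrow>
     (\<forall>d\<in>sort_dom M (snd v). sat M (e(v := d)) p \<longleftrightarrow> sat M (e'(v := d)) q)"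
  by (auto simp: sat_apart)

lemma apart_formulas: "p \<in> formulas L \<Longrightarrow> ren_fm (apart v i) p \<in> formulas L"
  by (simp add: ren_formulas)

lemma free_vars_apart:
  "free_vars (conj_apart v p q) = apart v 0 ` free_vars p \<union> apart v (Suc 0) ` free_vars q"
  "free_vars (same_solutions v p q) =
     apart v 0 ` (free_vars p - {v}) \<union> apart v (Suc 0) ` (free_vars q - {v})"
  by (auto simp: free_vars_ren[OF inj_apart] simp del: split_paired_All)

text \<open>Replaces a capture-avoiding substitution of \<open>v\<close> for all of
  \<open>V\<close>. The relativized quantifier "for all \<open>w\<close> equal to \<open>v\<close>"
  pins \<open>w\<close> to the value of \<open>v\<close>, one variable at a time. The value
  \<open>e v\<close> has to lie in its sort because the quantifier ranges over that sort
  only.\<close>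

lemma identify_variables:
  fixes p :: "('s, 'f, 'r) fm"
  assumes "finite V" "\<And>u. u \<in> V \<Longrightarrow> snd u = snd v" "v \<notin> V" "p \<in> formulas L" "snd v \<in> sorts L"
  shows "\<exists>q \<in> formulas L. free_vars q \<subseteq> insert v (free_vars p - V) \<and>
     (\<forall>(M :: ('s, 'f, 'r, 'a) struct) e. e v \<in> sort_dom M (snd v) \<longrightarrow>
       sat M e q = sat M (\<lambda>u. if u \<in> V then e v else e u) p)"
  using assms(1-3)
proof (induction V rule: finite_induct)
  case empty
  then show ?case using assms(4) by (intro bexI[of _ p]) auto
next
  case (insert w V)
  then have "\<And>u. u \<in> V \<Longrightarrow> snd u = snd v" "v \<notin> V" by blast+
  with insert.IH obtain q where q: "q \<in> formulas L" "free_vars q \<subseteq> insert v (free_vars p - V)"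
    "\<And>(M :: ('s, 'f, 'r, 'a) struct) e. e v \<in> sort_dom M (snd v) \<Longrightarrow>
       sat M e q = sat M (\<lambda>u. if u \<in> V then e v else e u) p"
    by blast
  have w: "w \<noteq> v" "snd w = snd v" "w \<notin> V" using insert by auto
  let ?q = "All w (Imp (Equal (Var w) (Var v)) q)"
  have "sat M e ?q = sat M (\<lambda>u. if u \<in> insert w V then e v else e u) p"
    if e: "e v \<in> sort_dom M (snd v)" for M :: "('s, 'f, 'r, 'a) struct" and e
  proof -
    have "sat M e ?q = sat M (e(w := e v)) q" using w e by auto
    also have "\<dots> = sat M (\<lambda>u. if u \<in> V then (e(w := e v)) v else (e(w := e v)) u) p"
      using q(3)[of "e(w := e v)"] w e by simp
    also have "(\<lambda>u. if u \<in> V then (e(w := e v)) v else (e(w := e v)) u) =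
        (\<lambda>u. if u \<in> insert w V then e v else e u)"
      using w by auto
    finally show ?thesis .
  qed
  then show ?case
    using q w assms(5) by (intro bexI[of _ ?q]) auto
qed

section \<open>A transfinite construction\<close>

text \<open>The demands \<open>x \<in> D\<close> are met one after the other. Finite character lets
  \<open>P\<close> survive unions of chains, and each step sees fewer than \<open>\<kappa>\<close>
  earlier choices because \<open>D\<close> is ordered in the type of its own cardinal.\<close>

lemma transfinite_solution:
  fixes D :: "'d set" and P :: "'q set \<Rightarrow> bool" and \<kappa> :: "'k rel"
  assumes \<kappa>: "Card_order \<kappa>" "infinite (Field \<kappa>)"
    and D: "|D| \<le>o \<kappa>"
    and fin_char: "\<And>R. P R \<longleftrightarrow> (\<forall>F. finite F \<longrightarrow> F \<subseteq> R \<longrightarrow> P F)"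
    and step: "\<And>R x. P R \<Longrightarrow> |R| <o \<kappa> \<Longrightarrow> x \<in> D \<Longrightarrow> \<exists>q. P (insert q R) \<and> S x q"
    and R0: "P R0" "|R0| <o \<kappa>"
  obtains R where "R0 \<subseteq> R" "P R" "\<And>x. x \<in> D \<Longrightarrow> \<exists>q\<in>R. S x q"
proof -
  define w where "w = |D|"
  have w: "Well_order w" "Field w = D" "Card_order w"
    unfolding w_def using card_of_well_order_on[of D] card_of_Card_order[of D]
    by (simp_all add: Field_card_of)
  then have lin: "Linear_order w" and wf: "wf (w - Id)"
    by (auto simp: well_order_on_def)
  have refl: "(x, x) \<in> w" if "x \<in> D" for x
    using lin that w(2) by (simp add: order_on_defs refl_on_def)
  have trans: "trans w"
    using lin by (simp add: order_on_defs)
  have total: "(x, y) \<in> w \<or> (y, x) \<in> w" if "x \<in> D" "y \<in> D" for x y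
    using lin that w(2) refl[of x] unfolding order_on_defs total_on_def by (cases "x = y") simp_all
  \<comment> \<open>The choice is arbitrary if there is no suitable \<open>q\<close>;
    \<open>main\<close> shows that this does not happen on \<open>D\<close>.\<close>
  define H where "H Q x = (SOME q. P (insert q (R0 \<union> Q ` underS w x)) \<and> S x q)" for Q x
  define Q where "Q = wfrec (w - Id) H"
  have "adm_wf (w - Id) H"
    unfolding adm_wf_def H_def
  proof (intro allI impI)
    fix f g :: "'d \<Rightarrow> 'q" and x assume "\<forall>z. (z, x) \<in> w - Id \<longrightarrow> f z = g z"
    then have "f ` underS w x = g ` underS w x"
      by (intro image_cong) (auto simp: underS_def)
    then show "(SOME q. P (insert q (R0 \<union> f ` underS w x)) \<and> S x q) =
        (SOME q. P (insert q (R0 \<union> g ` underS w x)) \<and> S x q)" by simp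
  qed
  then have Q: "Q x = H Q x" for x
    unfolding Q_def by (rule fun_cong[OF wfrec_fixpoint[OF wf]])
  have mono: "P F" if "P R" "F \<subseteq> R" for F R
  proof (subst fin_char, intro allI impI)
    fix G assume "finite G" "G \<subseteq> F"
    then show "P G"
      using fin_char[of R] that by (simp add: subset_trans)
  qed
  \<comment> \<open>A finite subset of the union involves finitely many indices, hence lies in the
    stage of the greatest of them.\<close>
  have dir: "P (R0 \<union> Q ` A)"
    if A: "A \<subseteq> D" "\<And>x. x \<in> A \<Longrightarrow> P (R0 \<union> Q ` under w x)" for A
  proof (subst fin_char, intro allI impI)
    fix F assume F: "finite F" "F \<subseteq> R0 \<union> Q ` A"
    then have "finite (F - R0)" "F - R0 \<subseteq> Q ` A" by auto
    then obtain G where G: "G \<subseteq> A" "finite G" "F - R0 = Q ` G"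
      using finite_subset_image by metis
    show "P F"
    proof (cases "G = {}")
      case True
      then have "F \<subseteq> R0" using G(3) by auto
      then show ?thesis by (rule mono[OF R0(1)])
    next
      case False
      have "\<exists>m\<in>G. \<forall>x\<in>G. (x, m) \<in> w"
        using G(2) False G(1)
      proof (induction G rule: finite_ne_induct)
        case (singleton x)
        then show ?case using refl A(1) by auto
      next
        case (insert x F)
        then obtain m where m: "m \<in> F" "\<forall>y\<in>F. (y, m) \<in> w" by auto
        have xm: "x \<in> D" "m \<in> D" using insert.prems m(1) A(1) by auto
        from total[OF xm] show ?case
        proof
          assume "(x, m) \<in> w"
          then show ?thesis using m by auto
        next
          assume "(m, x) \<in> w"
          then have "\<forall>y\<in>F. (y, x) \<in> w" using m trans by (meson transD)
          then show ?thesis using refl[OF xm(1)] by auto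
        qed
      qed
      then obtain m where m: "m \<in> G" "\<forall>x\<in>G. (x, m) \<in> w" by blast
      then have "F \<subseteq> R0 \<union> Q ` under w m" using G(3) by (auto simp: under_def)
      then show ?thesis using m(1) G(1) by (intro mono[OF A(2)[of m]]) auto
    qed
  qed
  have main: "x \<in> D \<longrightarrow> P (R0 \<union> Q ` under w x) \<and> S x (Q x)" for x
  proof (induction x rule: wf_induct_rule[OF wf])
    case (1 x)
    show ?case
    proof
      assume x: "x \<in> D"
      have sub: "underS w x \<subseteq> D" using w(2) by (auto simp: underS_def Field_def)
      have "P (R0 \<union> Q ` underS w x)"
      proof (rule dir[OF sub])
        fix y assume "y \<in> underS w x"
        then show "P (R0 \<union> Q ` under w y)"
          using 1[of y] sub by (auto simp: underS_def)
      qed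
      moreover have "|R0 \<union> Q ` underS w x| <o \<kappa>"
      proof (rule card_of_Un_ordLess_infinite_Field[OF \<kappa>(2,1) R0(2)])
        have "|Q ` underS w x| \<le>o |underS w x|" by (rule card_of_image)
        also have "|underS w x| <o w" using x w by (intro card_of_underS) auto
        also have "w \<le>o \<kappa>" using D w_def by simp
        finally show "|Q ` underS w x| <o \<kappa>" .
      qed
      ultimately have "\<exists>q. P (insert q (R0 \<union> Q ` underS w x)) \<and> S x q"
        using step x by blast
      then have "P (insert (Q x) (R0 \<union> Q ` underS w x)) \<and> S x (Q x)"
        unfolding Q[of x] H_def by (rule someI_ex)
      moreover have "under w x = insert x (underS w x)"
        using refl[OF x] by (auto simp: under_def underS_def)
      ultimately show "P (R0 \<union> Q ` under w x) \<and> S x (Q x)" by simp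
    qed
  qed
  have "P (R0 \<union> Q ` D)"
    by (rule dir[OF subset_refl]) (rule main[THEN mp, THEN conjunct1])
  moreover have "\<exists>q\<in>R0 \<union> Q ` D. S x q" if "x \<in> D" for x
    using main[of x] that by blast
  ultimately show ?thesis
    by (rule that[OF Un_upper1])
qed

section \<open>Realizing types in the big model\<close>

locale big_model =
  fixes L :: "('s, 'f, 'r) signature" and M :: "('s, 'f, 'r, 'a) struct" and \<kappa> :: "'k rel"
  assumes wf_sig: "wf_signature L"
    and big: "big_saturated_model \<kappa> L M"
    and inf: "infinite (Field \<kappa>)"
begin

lemma card: "Card_order \<kappa>"
  and card_univ: "|univ L M| \<le>o \<kappa>"
  and saturated: "saturated_in \<kappa> L M"
  and sort_unique: "s \<in> sorts L \<Longrightarrow> t \<in> sorts L \<Longrightarrow> x \<in> sort_dom M s \<Longrightarrow> x \<in> sort_dom M t \<Longrightarrow> s = t"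
  and fun_closed: "f \<in> funs L \<Longrightarrow> list_all2 (\<lambda>x s. x \<in> sort_dom M s) xs (fun_args L f) \<Longrightarrow>
        fun_int M f xs \<in> sort_dom M (fun_res L f)"
  using big unfolding big_saturated_model_def wf_struct_def by blast+

text \<open>A complete type in variables labelled by \<open>'y\<close>, with sorts given by \<open>srt\<close>, is a predicate
  \<open>Th\<close> on pairs \<open>(p, h)\<close>, where \<open>h\<close> maps the free variables of \<open>p\<close> to labels. The relation \<open>R\<close>
  is a (possibly partial) realization of it.\<close>

definition realizes ::
  "('y \<Rightarrow> 's) \<Rightarrow> (('s, 'f, 'r) fm \<Rightarrow> ('s var \<Rightarrow> 'y) \<Rightarrow> bool) \<Rightarrow> ('y \<times> 'a) set \<Rightarrow> bool" where
  "realizes srt Th R \<longleftrightarrow>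
     (\<forall>(y, x)\<in>R. srt y \<in> sorts L \<and> x \<in> sort_dom M (srt y)) \<and>
     (\<forall>p\<in>formulas L. \<forall>h e. (\<forall>u\<in>free_vars p. (h u, e u) \<in> R \<and> srt (h u) = snd u) \<longrightarrow>
        (Th p h \<longleftrightarrow> sat M e p))"

text \<open>Stronger than finite satisfiability: one tuple of \<open>M\<close> realizes all formulas
  over the finite label set \<open>F\<close> at once. Such tuples are at hand in both applications,
  namely the identity in \<open>fin_realized_sat\<close> and the tuples of \<open>a\<close> in
  \<open>continuation_exists\<close>.\<close>

definition fin_realized ::
  "('y \<Rightarrow> 's) \<Rightarrow> (('s, 'f, 'r) fm \<Rightarrow> ('s var \<Rightarrow> 'y) \<Rightarrow> bool) \<Rightarrow> 'y set \<Rightarrow> bool" where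
  "fin_realized srt Th Y \<longleftrightarrow> (\<forall>y\<in>Y. srt y \<in> sorts L) \<and>
     (\<forall>F. finite F \<longrightarrow> F \<subseteq> Y \<longrightarrow> (\<exists>g. (\<forall>y\<in>F. g y \<in> sort_dom M (srt y)) \<and>
        (\<forall>p\<in>formulas L. \<forall>h. (\<forall>u\<in>free_vars p. h u \<in> F \<and> srt (h u) = snd u) \<longrightarrow>
           (Th p h \<longleftrightarrow> sat M (g \<circ> h) p))))"

lemma realizesD:
  assumes "realizes srt Th R"
  shows "(y, x) \<in> R \<Longrightarrow> srt y \<in> sorts L" "(y, x) \<in> R \<Longrightarrow> x \<in> sort_dom M (srt y)"
    "(y, x) \<in> R \<Longrightarrow> x \<in> univ L M"
    "p \<in> formulas L \<Longrightarrow> (\<And>u. u \<in> free_vars p \<Longrightarrow> (h u, e u) \<in> R) \<Longrightarrow>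
       (\<And>u. u \<in> free_vars p \<Longrightarrow> srt (h u) = snd u) \<Longrightarrow> Th p h \<longleftrightarrow> sat M e p"
  using assms unfolding realizes_def univ_def by blast+

lemma fin_realizedE:
  assumes "fin_realized srt Th Y" "finite F" "F \<subseteq> Y"
  obtains g where "\<forall>y\<in>F. g y \<in> sort_dom M (srt y)"
    "\<And>p h. p \<in> formulas L \<Longrightarrow> \<forall>u\<in>free_vars p. h u \<in> F \<and> srt (h u) = snd u \<Longrightarrow>
       Th p h \<longleftrightarrow> sat M (g \<circ> h) p"
proof -
  have "\<exists>g. (\<forall>y\<in>F. g y \<in> sort_dom M (srt y)) \<and>
        (\<forall>p\<in>formulas L. \<forall>h. (\<forall>u\<in>free_vars p. h u \<in> F \<and> srt (h u) = snd u) \<longrightarrow>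
           (Th p h \<longleftrightarrow> sat M (g \<circ> h) p))"
    using assms unfolding fin_realized_def by simp
  then show thesis using that by (elim exE conjE) simp
qed

text \<open>A formula has finitely many free variables and so tests \<open>R\<close> on finitely
  many pairs. This is the finite character that \<open>transfinite_solution\<close> demands.\<close>

lemma realizes_fin_char:
  "realizes srt Th R \<longleftrightarrow> (\<forall>F. finite F \<longrightarrow> F \<subseteq> R \<longrightarrow> realizes srt Th F)"
proof (intro iffI allI impI)
  fix F assume "realizes srt Th R" "finite F" "F \<subseteq> R"
  then show "realizes srt Th F" unfolding realizes_def by blast
next
  assume *: "\<forall>F. finite F \<longrightarrow> F \<subseteq> R \<longrightarrow> realizes srt Th F"
  show "realizes srt Th R"
    unfolding realizes_def
  proof (intro conjI ballI allI impI)
    fix z assume "z \<in> R"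
    then have "realizes srt Th {z}" using * by simp
    then show "case z of (y, x) \<Rightarrow> srt y \<in> sorts L \<and> x \<in> sort_dom M (srt y)"
      by (simp add: realizes_def)
  next
    fix p h e
    assume p: "p \<in> formulas L" "\<forall>u\<in>free_vars p. (h u, e u) \<in> R \<and> srt (h u) = snd u"
    let ?F = "(\<lambda>u. (h u, e u)) ` free_vars p"
    have "finite ?F" "?F \<subseteq> R" using p(2) finite_free_vars[of p] by auto
    then have "realizes srt Th ?F" using * by simp
    then show "Th p h \<longleftrightarrow> sat M e p"
      using p by (intro realizesD(4)[of srt Th ?F]) auto
  qed
qed

text \<open>Saturation handles formulas with one distinguished variable \<open>v\<close> and yields
  one implication. In general the new pair may sit at several variables, which are merged into
  \<open>v\<close>; the other implication comes from the negated formula.\<close>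

lemma realizes_insert:
  assumes R: "realizes srt Th R" and Y: "fin_realized srt Th Y" "fst ` R \<subseteq> Y" "z \<in> Y"
    and v: "snd v = srt z" "fst v = 0" and d: "d \<in> sort_dom M (srt z)"
    and sat: "\<And>p h e. p \<in> formulas L \<Longrightarrow> (\<And>u. u \<in> free_vars p - {v} \<Longrightarrow> (h u, e u) \<in> R) \<Longrightarrow>
       (\<And>u. u \<in> free_vars p - {v} \<Longrightarrow> srt (h u) = snd u) \<Longrightarrow> Th p (h(v := z)) \<Longrightarrow> sat M (e(v := d)) p"
  shows "realizes srt Th (insert (z, d) R)"
proof -
  have zs: "srt z \<in> sorts L" using Y by (auto simp: fin_realized_def)
  have "Th p h \<longleftrightarrow> sat M e p"
    if p: "p \<in> formulas L" and he: "\<forall>u\<in>free_vars p. (h u, e u) \<in> insert (z, d) R \<and> srt (h u) = snd u"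
    for p h e
  proof -
    \<comment> \<open>Shifting all numbers by one frees the number 0, which belongs to
      \<open>v\<close>.\<close>
    define \<rho> :: "'s var \<Rightarrow> 's var" where "\<rho> = (\<lambda>(n, s). (Suc n, s))"
    define pre :: "'s var \<Rightarrow> 's var" where "pre = (\<lambda>(n, s). (n - 1, s))"
    have \<rho>: "inj \<rho>" "\<And>u. snd (\<rho> u) = snd u" "\<And>u. pre (\<rho> u) = u" "\<And>u. \<rho> u \<noteq> v"
      using v by (auto simp: \<rho>_def pre_def inj_on_def)
    \<comment> \<open>The variables that carry the new pair; all other free variables take their
      pairs from \<open>R\<close>.\<close>
    define V where "V = \<rho> ` {u \<in> free_vars p. (h u, e u) = (z, d)}"
    have V: "finite V" "\<And>u. u \<in> V \<Longrightarrow> snd u = snd v"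
      using finite_free_vars[of p] he v \<rho>(2) by (auto simp: V_def)
    have vV: "v \<notin> V" using \<rho>(4) unfolding V_def by blast
    have "\<exists>q \<in> formulas L. free_vars q \<subseteq> insert v (free_vars (ren_fm \<rho> p) - V) \<and>
       (\<forall>(M :: ('s, 'f, 'r, 'a) struct) e. e v \<in> sort_dom M (snd v) \<longrightarrow>
         sat M e q = sat M (\<lambda>u. if u \<in> V then e v else e u) (ren_fm \<rho> p))"
      using zs v(1) by (intro identify_variables[OF V vV ren_formulas[OF \<rho>(2) p]]) simp_all
    then obtain q where q: "q \<in> formulas L" "free_vars q \<subseteq> insert v (free_vars (ren_fm \<rho> p) - V)"
      "\<And>(M :: ('s, 'f, 'r, 'a) struct) e. e v \<in> sort_dom M (snd v) \<Longrightarrow>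
         sat M e q = sat M (\<lambda>u. if u \<in> V then e v else e u) (ren_fm \<rho> p)"
      by blast
    have sat_q: "sat M ((e' \<circ> pre)(v := c)) q \<longleftrightarrow> sat M e' p"
      if c: "c \<in> sort_dom M (srt z)" "\<And>u. u \<in> free_vars p \<Longrightarrow> (h u, e u) = (z, d) \<Longrightarrow> e' u = c" for e' c
    proof -
      let ?e = "(e' \<circ> pre)(v := c)"
      have "sat M ?e q \<longleftrightarrow> sat M (\<lambda>u. if u \<in> V then ?e v else ?e u) (ren_fm \<rho> p)"
        by (rule q(3)) (use c v in simp)
      also have "\<dots> \<longleftrightarrow> sat M e' p"
        unfolding sat_ren[OF \<rho>(1,2)]
      proof (rule sat_cong)
        fix u assume u: "u \<in> free_vars p"
        have "\<rho> u \<in> V \<longleftrightarrow> (h u, e u) = (z, d)"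
          unfolding V_def inj_image_mem_iff[OF \<rho>(1)] using u by simp
        then show "((\<lambda>u. if u \<in> V then ?e v else ?e u) \<circ> \<rho>) u = e' u"
          using c(2)[OF u] \<rho>(3,4)[of u] by (cases "\<rho> u \<in> V") simp_all
      qed
      finally show ?thesis .
    qed
    have qR: "((h \<circ> pre) u, (e \<circ> pre) u) \<in> R \<and> srt ((h \<circ> pre) u) = snd u" if uq: "u \<in> free_vars q - {v}" for u
    proof -
      obtain w where w: "u = \<rho> w" "w \<in> free_vars p" "\<rho> w \<notin> V"
        using q(2) uq unfolding free_vars_ren[OF \<rho>(1)] by blast
      have "(h w, e w) \<noteq> (z, d)" using w(2,3) unfolding V_def by blast
      then have "(h w, e w) \<in> R" "srt (h w) = snd w" using he w(2) by blast+
      then show ?thesis using w(1) \<rho> by simp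
    qed
    \<comment> \<open>\<open>Th\<close> is an abstract predicate, so its agreement on
      \<open>p\<close> and \<open>q\<close> has to be read off from a tuple \<open>g\<close> that
      realizes it on the finitely many labels involved.\<close>
    let ?F = "insert z (h ` free_vars p)"
    have F: "finite ?F" "?F \<subseteq> Y" using finite_free_vars[of p] Y he by force+
    obtain g where g: "\<forall>y\<in>?F. g y \<in> sort_dom M (srt y)"
      "\<And>p h. p \<in> formulas L \<Longrightarrow> \<forall>u\<in>free_vars p. h u \<in> ?F \<and> srt (h u) = snd u \<Longrightarrow>
       Th p h \<longleftrightarrow> sat M (g \<circ> h) p"
      using fin_realizedE[OF Y(1) F] by metis
    let ?h = "(h \<circ> pre)(v := z)"
    have hF: "?h u \<in> ?F" "srt (?h u) = snd u" if uq: "u \<in> free_vars q" for u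
    proof -
      from uq consider "u = v" | w where "u = \<rho> w" "w \<in> free_vars p"
        using q(2) unfolding free_vars_ren[OF \<rho>(1)] by blast
      then have "?h u \<in> ?F \<and> srt (?h u) = snd u"
        using v \<rho> he by cases simp_all
      then show "?h u \<in> ?F" "srt (?h u) = snd u" by simp_all
    qed
    have gh: "g \<circ> ?h = (g \<circ> h \<circ> pre)(v := g z)" by (auto simp: fun_eq_iff)
    have "Th p h \<longleftrightarrow> sat M (g \<circ> h) p"
      using p he by (intro g(2)) auto
    also have "\<dots> \<longleftrightarrow> sat M (g \<circ> ?h) q"
      unfolding gh by (rule sat_q[symmetric]) (use g(1) in auto)
    finally have Thq: "Th p h \<longleftrightarrow> sat M (g \<circ> ?h) q" .
    have Th_q: "Th q ?h \<longleftrightarrow> sat M (g \<circ> ?h) q" "Th (Neg q) ?h \<longleftrightarrow> \<not> sat M (g \<circ> ?h) q"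
      using q(1) hF by (subst g(2); simp)+
    have e_q: "sat M ((e \<circ> pre)(v := d)) q \<longleftrightarrow> sat M e p"
      by (rule sat_q) (use d in auto)
    show ?thesis
    proof (cases "sat M (g \<circ> ?h) q")
      case True
      then have "sat M ((e \<circ> pre)(v := d)) q"
        using Th_q qR q(1) by (intro sat[of q "h \<circ> pre"]) auto
      then show ?thesis using True Thq e_q by simp
    next
      case False
      then have "sat M ((e \<circ> pre)(v := d)) (Neg q)"
        using Th_q qR q(1) by (intro sat[of "Neg q" "h \<circ> pre"]) auto
      then show ?thesis using False Thq e_q by simp
    qed
  qed
  then show ?thesis
    using R zs d unfolding realizes_def by blast
qed

text \<open>The formulas that \<open>Th\<close> prescribes for \<open>z\<close>, with the values in
  \<open>R\<close> as parameters, form a type over fewer than \<open>\<kappa>\<close> elements. Each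
  of them is satisfiable because its existential quantification over \<open>v\<close> belongs to
  \<open>Th\<close> and thus holds at the values in \<open>R\<close>; finitely many of them are
  conjoined into one.\<close>

lemma realize_one:
  assumes Y: "fin_realized srt Th Y" "fst ` R \<subseteq> Y" "z \<in> Y"
    and R: "realizes srt Th R" "|R| <o \<kappa>"
  obtains d where "realizes srt Th (insert (z, d) R)"
proof -
  define v where "v = (0 :: nat, srt z)"
  have zs: "srt z \<in> sorts L" using Y by (auto simp: fin_realized_def)
  define par where "par p h e \<longleftrightarrow> p \<in> formulas L \<and>
     (\<forall>u\<in>free_vars p - {v}. (h u, e u) \<in> R \<and> srt (h u) = snd u)" for p :: "('s, 'f, 'r) fm" and h e
  define \<Sigma> where "\<Sigma> = {(p, e). \<exists>h. par p h e \<and> Th p (h(v := z))}"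
  have approx: "\<exists>g. g z \<in> sort_dom M (snd v) \<and>
      (\<forall>q h. q \<in> formulas L \<longrightarrow> (\<forall>u\<in>free_vars q. h u \<in> F \<and> srt (h u) = snd u) \<longrightarrow>
        (Th q h \<longleftrightarrow> sat M (g \<circ> h) q))"
    if F: "finite F" "F \<subseteq> Y" "z \<in> F" for F
  proof -
    obtain g where g: "\<forall>y\<in>F. g y \<in> sort_dom M (srt y)"
      "\<And>p h. p \<in> formulas L \<Longrightarrow> \<forall>u\<in>free_vars p. h u \<in> F \<and> srt (h u) = snd u \<Longrightarrow>
       Th p h \<longleftrightarrow> sat M (g \<circ> h) p"
      using fin_realizedE[OF Y(1) F(1,2)] by metis
    then show ?thesis using F(3) by (intro exI[of _ g]) (simp add: v_def)
  qed
  define lab where "lab p h = insert z (h ` (free_vars p - {v}))" for p :: "('s, 'f, 'r) fm" and h :: "'s var \<Rightarrow> 'b"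
  have lab: "finite (lab p h)" "lab p h \<subseteq> Y" "z \<in> lab p h" if "par p h e" for p h e
    using that Y(2,3) finite_free_vars[of p] unfolding lab_def par_def by force+
  have nonempty: "\<exists>d\<in>sort_dom M (snd v). d \<in> solutions M v (p, e)" if pe: "(p, e) \<in> \<Sigma>" for p e
  proof -
    obtain h where h: "par p h e" "Th p (h(v := z))" using pe by (auto simp: \<Sigma>_def)
    obtain g where g: "g z \<in> sort_dom M (snd v)"
      "\<And>q h'. q \<in> formulas L \<Longrightarrow> \<forall>u\<in>free_vars q. h' u \<in> lab p h \<and> srt (h' u) = snd u \<Longrightarrow>
        Th q h' \<longleftrightarrow> sat M (g \<circ> h') q"
      using approx[OF lab[OF h(1)]] by blast
    have "sat M (g \<circ> h(v := z)) p"
      using h g(2)[of p "h(v := z)"] by (auto simp: par_def lab_def v_def)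
    then have "sat M ((g \<circ> h)(v := g z)) p" by (simp add: fun_upd_comp)
    \<comment> \<open>The existential formula no longer mentions \<open>z\<close>, so
      \<open>Th\<close> can carry it from the approximating tuple \<open>g\<close> to the actual
      values \<open>e\<close>.\<close>
    then have "sat M (g \<circ> h) (Ex_fm v p)" using g(1) by auto
    then have "Th (Ex_fm v p) h"
      using h(1) g(2)[of "Ex_fm v p" h] zs by (auto simp: par_def lab_def v_def)
    then have "sat M e (Ex_fm v p)"
      using realizesD(4)[OF R(1), of "Ex_fm v p" h e] h(1) zs by (auto simp: par_def v_def)
    then show ?thesis by (auto simp: solutions_def)
  qed
  have merge: "\<exists>pe\<in>\<Sigma>. \<forall>d\<in>solutions M v pe. \<forall>pe'\<in>\<Sigma>0. d \<in> solutions M v pe'"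
    if "finite \<Sigma>0" "\<Sigma>0 \<subseteq> \<Sigma>" for \<Sigma>0
    using that
  proof (induction \<Sigma>0 rule: finite_induct)
    case empty
    obtain g where g: "\<And>q h. q \<in> formulas L \<Longrightarrow> \<forall>u\<in>free_vars q. h u \<in> {z} \<and> srt (h u) = snd u \<Longrightarrow>
        Th q h \<longleftrightarrow> sat M (g \<circ> h) q"
      using approx[of "{z}"] Y(3) by blast
    have "(Neg Falsum, undefined) \<in> \<Sigma>"
      using g[of "Neg Falsum"] by (auto simp: \<Sigma>_def par_def)
    then show ?case by auto
  next
    case (insert pe2 \<Sigma>0)
    then obtain pe1 where "pe1 \<in> \<Sigma>" and pe1: "\<forall>d\<in>solutions M v pe1. \<forall>pe'\<in>\<Sigma>0. d \<in> solutions M v pe'"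
      by auto
    then obtain p1 e1 h1 where 1: "pe1 = (p1, e1)" "par p1 h1 e1" "Th p1 (h1(v := z))"
      by (auto simp: \<Sigma>_def)
    obtain p2 e2 h2 where 2: "pe2 = (p2, e2)" "par p2 h2 e2" "Th p2 (h2(v := z))"
      using insert.prems by (auto simp: \<Sigma>_def)
    let ?p = "conj_apart v p1 p2" and ?e = "join_val v e1 e2" and ?h = "join_val v h1 h2"
    have form: "p1 \<in> formulas L" "p2 \<in> formulas L" using 1 2 by (auto simp: par_def)
    have par: "par ?p ?h ?e"
      using 1(2) 2(2) unfolding par_def
      by (auto simp: free_vars_apart apart_formulas join_val_apart simp del: free_vars.simps)
    obtain g where g: "g z \<in> sort_dom M (snd v)"
      "\<And>q h'. q \<in> formulas L \<Longrightarrow>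
        \<forall>u\<in>free_vars q. h' u \<in> lab p1 h1 \<union> lab p2 h2 \<and> srt (h' u) = snd u \<Longrightarrow>
        Th q h' \<longleftrightarrow> sat M (g \<circ> h') q"
      using approx[of "lab p1 h1 \<union> lab p2 h2"] lab[OF 1(2)] lab[OF 2(2)] by auto
    have "sat M (g \<circ> h1(v := z)) p1" "sat M (g \<circ> h2(v := z)) p2"
      using 1 2 g(2)[of p1 "h1(v := z)"] g(2)[of p2 "h2(v := z)"]
      by (auto simp: par_def lab_def v_def)
    then have "sat M (g \<circ> ?h(v := z)) ?p"
      unfolding fun_upd_comp comp_join_val sat_conj_apart by simp
    moreover have "\<forall>u\<in>free_vars ?p. (?h(v := z)) u \<in> lab p1 h1 \<union> lab p2 h2 \<and> srt ((?h(v := z)) u) = snd u"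
    proof
      fix u assume "u \<in> free_vars ?p"
      then consider w where "w \<in> free_vars p1" "u = apart v 0 w"
        | w where "w \<in> free_vars p2" "u = apart v (Suc 0) w"
        unfolding free_vars_apart by blast
      then show "(?h(v := z)) u \<in> lab p1 h1 \<union> lab p2 h2 \<and> srt ((?h(v := z)) u) = snd u"
      proof cases
        case (1 w)
        then show ?thesis using \<open>par p1 h1 e1\<close> v_def
          by (cases "w = v") (simp_all add: par_def lab_def join_val_apart)
      next
        case (2 w)
        then show ?thesis using \<open>par p2 h2 e2\<close> v_def
          by (cases "w = v") (simp_all add: par_def lab_def join_val_apart)
      qed
    qed
    ultimately have "Th ?p (?h(v := z))"
      using g(2)[of ?p "?h(v := z)"] form by (simp add: apart_formulas)
    then have "(?p, ?e) \<in> \<Sigma>" using par by (auto simp: \<Sigma>_def)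
    moreover have "\<forall>d\<in>solutions M v (?p, ?e). \<forall>pe'\<in>insert pe2 \<Sigma>0. d \<in> solutions M v pe'"
      using pe1 unfolding 1(1) 2(1) solutions_def by (simp only: prod.case mem_Collect_eq sat_conj_apart) auto
    ultimately show ?case by blast
  qed
  have "\<exists>d\<in>sort_dom M (snd v). \<forall>pe\<in>\<Sigma>. d \<in> solutions M v pe"
  proof (rule saturated[unfolded saturated_in_def, rule_format])
    show "snd ` R \<subseteq> univ L M" using realizesD(3)[OF R(1)] by auto
    show "small \<kappa> (snd ` R)"
      unfolding small_def by (rule ordLeq_ordLess_trans[OF card_of_image R(2)])
    show "snd v \<in> sorts L" using zs by (simp add: v_def)
    show "\<Sigma> \<subseteq> param_formulas L M v (snd ` R)"
      using realizesD(2)[OF R(1)] by (force simp: \<Sigma>_def par_def param_formulas_def)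
    fix \<Sigma>0 assume "finite \<Sigma>0" "\<Sigma>0 \<subseteq> \<Sigma>"
    then show "\<exists>d\<in>sort_dom M (snd v). \<forall>pe\<in>\<Sigma>0. d \<in> solutions M v pe"
      using merge nonempty by (metis surj_pair)
  qed
  then obtain d where d: "d \<in> sort_dom M (snd v)" "\<forall>pe\<in>\<Sigma>. d \<in> solutions M v pe" by blast
  have "realizes srt Th (insert (z, d) R)"
  proof (rule realizes_insert[OF R(1) Y, of v])
    fix p h e
    assume *: "p \<in> formulas L" "\<And>u. u \<in> free_vars p - {v} \<Longrightarrow> (h u, e u) \<in> R"
      "\<And>u. u \<in> free_vars p - {v} \<Longrightarrow> srt (h u) = snd u" "Th p (h(v := z))"
    then have "(p, e) \<in> \<Sigma>" unfolding \<Sigma>_def par_def by blast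
    then show "sat M (e(v := d)) p" using d by (auto simp: solutions_def)
  qed (use d in \<open>auto simp: v_def\<close>)
  then show ?thesis by (rule that)
qed

section \<open>Elementary relations and automorphisms\<close>

definition sort_of :: "'a \<Rightarrow> 's" where
  "sort_of x = (THE s. s \<in> sorts L \<and> x \<in> sort_dom M s)"

lemma sort_of_eq: "s \<in> sorts L \<Longrightarrow> x \<in> sort_dom M s \<Longrightarrow> sort_of x = s"
  unfolding sort_of_def using sort_unique by blast

lemma sort_of:
  assumes "x \<in> univ L M"
  shows "sort_of x \<in> sorts L" "x \<in> sort_dom M (sort_of x)"
  using assms sort_of_eq unfolding univ_def by auto

lemma sort_dom_univ: "s \<in> sorts L \<Longrightarrow> x \<in> sort_dom M s \<Longrightarrow> x \<in> univ L M"
  by (auto simp: univ_def)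

text \<open>A partial elementary map, kept as a set of pairs so that extension and inversion are
  plain set operations; single-valuedness is a consequence. The sort condition on \<open>e\<close>
  passes to \<open>e'\<close> because related elements have the same sort.\<close>

definition elementary :: "('a \<times> 'a) set \<Rightarrow> bool" where
  "elementary R \<longleftrightarrow> (\<forall>(x, y)\<in>R. x \<in> univ L M \<and> y \<in> univ L M \<and> sort_of x = sort_of y) \<and>
     (\<forall>p\<in>formulas L. \<forall>e e'. (\<forall>u\<in>free_vars p. (e u, e' u) \<in> R \<and> e u \<in> sort_dom M (snd u)) \<longrightarrow>
        (sat M e p \<longleftrightarrow> sat M e' p))"

lemma elementaryD:
  assumes "elementary R"
  shows "(x, y) \<in> R \<Longrightarrow> x \<in> univ L M" "(x, y) \<in> R \<Longrightarrow> y \<in> univ L M"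
    "(x, y) \<in> R \<Longrightarrow> sort_of x = sort_of y"
    "p \<in> formulas L \<Longrightarrow> \<forall>u\<in>free_vars p. (e u, e' u) \<in> R \<and> e u \<in> sort_dom M (snd u) \<Longrightarrow>
       sat M e p \<longleftrightarrow> sat M e' p"
  using assms unfolding elementary_def by blast+

text \<open>With the elements of \<open>M\<close> as labels and truth in \<open>M\<close> as the
  type, partial elementary maps are partial realizations, so \<open>realize_one\<close> provides the
  forth step.\<close>

lemma elementary_iff_realizes:
  "elementary R \<longleftrightarrow> fst ` R \<subseteq> univ L M \<and> realizes sort_of (\<lambda>p h. sat M h p) R"
proof
  assume R: "elementary R"
  have "(\<forall>u\<in>free_vars p. (h u, e u) \<in> R \<and> sort_of (h u) = snd u) \<longrightarrow>
      (\<forall>u\<in>free_vars p. (h u, e u) \<in> R \<and> h u \<in> sort_dom M (snd u))" for p :: "('s, 'f, 'r) fm" and h e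
    using elementaryD(1)[OF R] sort_of(2) by metis
  then show "fst ` R \<subseteq> univ L M \<and> realizes sort_of (\<lambda>p h. sat M h p) R"
    using R sort_of unfolding elementary_def realizes_def by fastforce
next
  assume R: "fst ` R \<subseteq> univ L M \<and> realizes sort_of (\<lambda>p h. sat M h p) R"
  show "elementary R"
    unfolding elementary_def
  proof (intro conjI ballI allI impI)
    fix z assume z: "z \<in> R"
    obtain x y where xy: "z = (x, y)" by (rule prod.exhaust)
    have "sort_of x \<in> sorts L" "y \<in> sort_dom M (sort_of x)" "y \<in> univ L M"
      using R z xy realizesD(1-3)[of sort_of "\<lambda>p h. sat M h p" R x y] by auto
    then show "case z of (x, y) \<Rightarrow> x \<in> univ L M \<and> y \<in> univ L M \<and> sort_of x = sort_of y"
      using z R xy sort_of_eq by force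
  next
    fix p e e'
    assume p: "p \<in> formulas L" "\<forall>u\<in>free_vars p. (e u, e' u) \<in> R \<and> e u \<in> sort_dom M (snd u)"
    show "sat M e p \<longleftrightarrow> sat M e' p"
      by (rule realizesD(4)[of sort_of "\<lambda>p h. sat M h p" R])
        (use R p sort_of_eq free_var_sort[OF p(1)] in \<open>simp_all\<close>)
  qed
qed

lemma elementary_converse:
  assumes R: "elementary R"
  shows "elementary (R\<inverse>)"
  unfolding elementary_def
proof (intro conjI ballI allI impI)
  fix z assume "z \<in> R\<inverse>"
  then show "case z of (x, y) \<Rightarrow> x \<in> univ L M \<and> y \<in> univ L M \<and> sort_of x = sort_of y"
    using elementaryD(1-3)[OF R] by force
next
  fix p e e'
  assume p: "p \<in> formulas L" "\<forall>u\<in>free_vars p. (e u, e' u) \<in> R\<inverse> \<and> e u \<in> sort_dom M (snd u)"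
  have "(e' u, e u) \<in> R \<and> e' u \<in> sort_dom M (snd u)" if u: "u \<in> free_vars p" for u
  proof -
    have *: "(e' u, e u) \<in> R" "e u \<in> sort_dom M (snd u)" using p(2) u by auto
    then show ?thesis
      using elementaryD(1,3)[OF R] sort_of[of "e' u"] sort_of_eq[of "snd u" "e u"]
        free_var_sort[OF p(1) u] by metis
  qed
  then show "sat M e p \<longleftrightarrow> sat M e' p"
    using elementaryD(4)[OF R p(1), of e' e] by blast
qed

lemma fin_realized_sat: "fin_realized sort_of (\<lambda>p h. sat M h p) (univ L M)"
  unfolding fin_realized_def using sort_of by (auto intro!: exI[of _ id])

lemma elementary_forth:
  assumes "elementary R" "|R| <o \<kappa>" "x \<in> univ L M"
  shows "\<exists>y. elementary (insert (x, y) R)"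
proof -
  have "fst ` R \<subseteq> univ L M" "realizes sort_of (\<lambda>p h. sat M h p) R"
    using assms(1) unfolding elementary_iff_realizes by auto
  from realize_one[OF fin_realized_sat this(1) assms(3) this(2) assms(2)] this assms(3)
  show ?thesis unfolding elementary_iff_realizes by force
qed

lemma image_converse_swap: "prod.swap ` R = R\<inverse>"
  by force

lemma card_of_converse_less: "|R| <o \<kappa> \<Longrightarrow> |R\<inverse>| <o \<kappa>"
  using ordLeq_ordLess_trans[OF card_of_image, of R \<kappa> prod.swap]
  by (simp add: image_converse_swap)

lemma elementary_back:
  assumes "elementary R" "|R| <o \<kappa>" "y \<in> univ L M"
  shows "\<exists>x. elementary (insert (x, y) R)"
proof -
  obtain x where "elementary (insert (y, x) (R\<inverse>))"
    using elementary_forth[OF elementary_converse[OF assms(1)] card_of_converse_less] assms(2,3) by blast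
  then have "elementary ((insert (y, x) (R\<inverse>))\<inverse>)" by (rule elementary_converse)
  moreover have "(insert (y, x) (R\<inverse>))\<inverse> = insert (x, y) R" by auto
  ultimately show ?thesis by auto
qed

text \<open>The equation of two variables holds at \<open>x\<close>, \<open>x\<close>, hence at the
  related pair \<open>y\<close>, \<open>y'\<close>.\<close>

lemma elementary_functional:
  assumes R: "elementary R" "(x, y) \<in> R" "(x, y') \<in> R"
  shows "y = y'"
proof -
  let ?s = "sort_of x"
  have x: "?s \<in> sorts L" "x \<in> sort_dom M ?s" using sort_of elementaryD(1)[OF R(1,2)] by auto
  have "sat M (\<lambda>_. x) (Equal (Var (0, ?s)) (Var (1, ?s))) \<longleftrightarrow>
      sat M (\<lambda>u. if fst u = 0 then y else y') (Equal (Var (0, ?s)) (Var (1, ?s)))"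
    by (rule elementaryD(4)[OF R(1)]) (use x R in auto)
  then show ?thesis by simp
qed

section \<open>Elementary maps of the whole universe and automorphisms\<close>

abbreviation graph :: "('a \<Rightarrow> 'a) \<Rightarrow> ('a \<times> 'a) set" where
  "graph \<sigma> \<equiv> (\<lambda>x. (x, \<sigma> x)) ` univ L M"

lemma sat_elementary_map:
  assumes "elementary (graph \<sigma>)" "p \<in> formulas L" "\<And>u. u \<in> free_vars p \<Longrightarrow> e u \<in> sort_dom M (snd u)"
  shows "sat M (\<sigma> \<circ> e) p \<longleftrightarrow> sat M e p"
proof -
  have "(e u, (\<sigma> \<circ> e) u) \<in> graph \<sigma> \<and> e u \<in> sort_dom M (snd u)" if "u \<in> free_vars p" for u
    using assms(3)[OF that] sort_dom_univ[OF free_var_sort[OF assms(2) that]] by simp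
  then show ?thesis using elementaryD(4)[OF assms(1,2)] by blast
qed

lemma elementary_map_sort:
  assumes "elementary (graph \<sigma>)" "s \<in> sorts L" "x \<in> sort_dom M s"
  shows "\<sigma> x \<in> sort_dom M s"
proof -
  have "(x, \<sigma> x) \<in> graph \<sigma>" using sort_dom_univ[OF assms(2,3)] by simp
  then show ?thesis
    using elementaryD(2,3)[OF assms(1)] sort_of(2)[of "\<sigma> x"] sort_of_eq[OF assms(2,3)] by metis
qed

text \<open>Compatibility with the symbols is elementarity for atomic formulas in distinct
  variables: the argument at position \<open>i\<close> gets variable number \<open>i\<close>, and
  the value of a function gets the next free number.\<close>

lemma elementary_map_automorphism:
  assumes \<sigma>: "elementary (graph \<sigma>)" and surj: "univ L M \<subseteq> \<sigma> ` univ L M"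
  shows "automorphism L M \<sigma>"
  unfolding automorphism_def
proof (intro conjI ballI allI impI)
  note sorts = elementary_map_sort[OF \<sigma>]
  fix s assume s: "s \<in> sorts L"
  have "inj_on \<sigma> (univ L M)"
    by (rule inj_onI, rule elementary_functional[OF elementary_converse[OF \<sigma>]]) auto
  moreover have "\<exists>x\<in>sort_dom M s. \<sigma> x = y" if y: "y \<in> sort_dom M s" for y
  proof -
    obtain x where x: "x \<in> univ L M" "\<sigma> x = y" using surj sort_dom_univ[OF s y] by blast
    then have "sort_of x = s"
      using sorts[OF sort_of(1,2)[OF x(1)]] sort_of(1)[OF x(1)] y s sort_unique by metis
    then show ?thesis using x sort_of(2)[OF x(1)] by auto
  qed
  ultimately show "bij_betw \<sigma> (sort_dom M s) (sort_dom M s)"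
    unfolding bij_betw_def inj_on_def using sorts[OF s] sort_dom_univ[OF s] by blast
next
  fix f xs
  assume f: "f \<in> funs L" and xs: "list_all2 (\<lambda>x s. x \<in> sort_dom M s) xs (fun_args L f)"
  let ?n = "length xs" and ?y = "fun_int M f xs"
  define vs where "vs = map (\<lambda>i. (i, fun_args L f ! i)) [0..<?n]"
  define w where "w = (?n, fun_res L f)"
  define e where "e u = (if fst u < ?n then xs ! fst u else ?y)" for u :: "'s var"
  have len: "length (fun_args L f) = ?n" and nth: "i < ?n \<Longrightarrow> xs ! i \<in> sort_dom M (fun_args L f ! i)" for i
    using xs by (auto simp: list_all2_conv_all_nth)
  have map_e: "map e vs = xs" by (auto simp: vs_def e_def intro: nth_equalityI)
  have ew: "e w = ?y" by (simp add: e_def w_def)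
  let ?p = "Equal (App f (map Var vs)) (Var w) :: ('s, 'f, 'r) fm"
  have srts: "set (fun_args L f) \<subseteq> sorts L" "fun_res L f \<in> sorts L"
    using wf_sig f by (auto simp: wf_signature_def)
  have "?p \<in> formulas L"
    using f srts len unfolding formulas_def vs_def w_def
    by (auto simp: comp_def subset_iff intro!: nth_equalityI)
  then have "sat M (\<sigma> \<circ> e) ?p \<longleftrightarrow> sat M e ?p"
    by (rule sat_elementary_map[OF \<sigma>])
      (use nth len fun_closed[OF f xs] in \<open>auto simp: vs_def e_def w_def\<close>)
  moreover have "map (\<lambda>x. \<sigma> (e x)) vs = map \<sigma> xs" unfolding map_e[symmetric] by simp
  ultimately show "\<sigma> ?y = fun_int M f (map \<sigma> xs)"
    using ew map_e by (simp add: comp_def)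
next
  fix R xs
  assume R: "R \<in> rels L" and xs: "list_all2 (\<lambda>x s. x \<in> sort_dom M s) xs (rel_args L R)"
  let ?n = "length xs"
  define vs where "vs = map (\<lambda>i. (i, rel_args L R ! i)) [0..<?n]"
  define e where "e u = xs ! fst u" for u :: "'s var"
  have len: "length (rel_args L R) = ?n" and nth: "i < ?n \<Longrightarrow> xs ! i \<in> sort_dom M (rel_args L R ! i)" for i
    using xs by (auto simp: list_all2_conv_all_nth)
  have map_e: "map e vs = xs" by (auto simp: vs_def e_def intro: nth_equalityI)
  let ?p = "Pred R (map Var vs) :: ('s, 'f, 'r) fm"
  have srts: "set (rel_args L R) \<subseteq> sorts L"
    using wf_sig R by (auto simp: wf_signature_def)
  have "?p \<in> formulas L"
    using R srts len unfolding formulas_def vs_def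
    by (auto simp: comp_def subset_iff intro!: nth_equalityI)
  then have "sat M (\<sigma> \<circ> e) ?p \<longleftrightarrow> sat M e ?p"
    by (rule sat_elementary_map[OF \<sigma>]) (use nth len in \<open>auto simp: vs_def e_def\<close>)
  moreover have "map (\<lambda>x. \<sigma> (e x)) vs = map \<sigma> xs" unfolding map_e[symmetric] by simp
  ultimately show "rel_int M R xs \<longleftrightarrow> rel_int M R (map \<sigma> xs)"
    using map_e by (simp add: comp_def)
qed

text \<open>Back-and-forth along two copies of the universe: \<open>Inl x\<close> demands that
  \<open>x\<close> enter the domain, \<open>Inr y\<close> that \<open>y\<close> enter the range.
  Elementarity is returned as well, since \<open>automorphism\<close> speaks of symbols only and
  later steps apply \<open>\<sigma>\<close> to arbitrary formulas.\<close>

lemma automorphism_extends: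
  assumes R0: "elementary R0" "|R0| <o \<kappa>"
  obtains \<sigma> where "automorphism L M \<sigma>" "elementary (graph \<sigma>)" "\<And>x y. (x, y) \<in> R0 \<Longrightarrow> \<sigma> x = y"
proof -
  define S where "S t q = (case t of Inl x \<Rightarrow> fst q = x | Inr y \<Rightarrow> snd q = y)"
    for t :: "'a + 'a" and q :: "'a \<times> 'a"
  let ?D = "univ L M <+> univ L M"
  have "\<exists>R. R0 \<subseteq> R \<and> elementary R \<and> (\<forall>t\<in>?D. \<exists>q\<in>R. S t q)"
  proof (rule transfinite_solution[OF card inf, of ?D elementary S R0])
    show "|?D| \<le>o \<kappa>"
      using card_of_Plus_ordLeq_infinite_Field[OF inf card_univ card_univ card] .
    show "elementary R \<longleftrightarrow> (\<forall>F. finite F \<longrightarrow> F \<subseteq> R \<longrightarrow> elementary F)" for R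
    proof
      show "elementary R \<Longrightarrow> \<forall>F. finite F \<longrightarrow> F \<subseteq> R \<longrightarrow> elementary F"
        unfolding elementary_def by blast
      assume F: "\<forall>F. finite F \<longrightarrow> F \<subseteq> R \<longrightarrow> elementary F"
      have "realizes sort_of (\<lambda>p h. sat M h p) R"
        using F unfolding realizes_fin_char[of _ _ R] elementary_iff_realizes by simp
      moreover have "fst ` R \<subseteq> univ L M"
      proof
        fix x assume "x \<in> fst ` R"
        then obtain y where "(x, y) \<in> R" by force
        then have "elementary {(x, y)}" using F by simp
        then show "x \<in> univ L M" by (simp add: elementary_def)
      qed
      ultimately show "elementary R" by (simp add: elementary_iff_realizes)
    qed
    show "\<exists>q. elementary (insert q R) \<and> S t q" if R: "elementary R" "|R| <o \<kappa>" "t \<in> ?D" for R t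
    proof (cases t)
      case (Inl x)
      then obtain y where "elementary (insert (x, y) R)"
        using elementary_forth[OF R(1,2)] R(3) by blast
      then show ?thesis using Inl by (intro exI[of _ "(x, y)"]) (simp add: S_def)
    next
      case (Inr y)
      then obtain x where "elementary (insert (x, y) R)"
        using elementary_back[OF R(1,2)] R(3) by blast
      then show ?thesis using Inr by (intro exI[of _ "(x, y)"]) (simp add: S_def)
    qed
  qed (use R0 in blast)+
  then obtain R where R: "R0 \<subseteq> R" "elementary R" "\<forall>t\<in>?D. \<exists>q\<in>R. S t q" by blast
  define \<sigma> where "\<sigma> x = (THE y. (x, y) \<in> R)" for x
  have \<sigma>: "\<sigma> x = y" if "(x, y) \<in> R" for x y
    unfolding \<sigma>_def using elementary_functional[OF R(2)] that by blast
  have dom: "\<exists>y. (x, y) \<in> R" and ran: "\<exists>y. (y, x) \<in> R" if x: "x \<in> univ L M" for x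
  proof -
    obtain q q' where q: "q \<in> R" "S (Inl x) q" "q' \<in> R" "S (Inr x) q'"
      using bspec[OF R(3) InlI[OF x]] bspec[OF R(3) InrI[OF x]] by (elim bexE) simp
    show "\<exists>y. (x, y) \<in> R" using q(1,2) by (cases q) (auto simp: S_def)
    show "\<exists>y. (y, x) \<in> R" using q(3,4) by (cases q') (auto simp: S_def)
  qed
  have graph: "graph \<sigma> = R"
    using \<sigma> dom elementaryD(1)[OF R(2)] by force
  have "univ L M \<subseteq> \<sigma> ` univ L M"
    using ran \<sigma> elementaryD(1)[OF R(2)] by blast
  then show ?thesis
    using R graph \<sigma> by (intro that[of \<sigma>] elementary_map_automorphism) auto
qed

section \<open>Definable closure\<close>

lemma elementary_map_fixes_dcl:
  assumes \<sigma>: "elementary (graph \<sigma>)" and A: "\<And>x. x \<in> A \<Longrightarrow> \<sigma> x = x" and d: "d \<in> dcl L M A"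
  shows "\<sigma> d = d"
proof -
  obtain v p e where v: "snd v \<in> sorts L" and p: "p \<in> formulas L"
    and e: "\<And>u. u \<in> free_vars p - {v} \<Longrightarrow> e u \<in> A \<inter> sort_dom M (snd u)"
    and sol: "solutions M v (p, e) = {d}"
    using d unfolding dcl_def param_formulas_def by blast
  have d: "d \<in> sort_dom M (snd v)" "sat M (e(v := d)) p"
    using sol by (auto simp: solutions_def)
  have "sat M (\<sigma> \<circ> (e(v := d))) p"
    using sat_elementary_map[OF \<sigma> p, of "e(v := d)"] d e by (metis DiffI IntD2 fun_upd_apply singletonD)
  moreover have "sat M (\<sigma> \<circ> (e(v := d))) p \<longleftrightarrow> sat M (e(v := \<sigma> d)) p"
    by (rule sat_cong) (use A e in auto)
  ultimately have "\<sigma> d \<in> solutions M v (p, e)"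
    using elementary_map_sort[OF \<sigma> v d(1)] by (simp add: solutions_def)
  then show ?thesis using sol by simp
qed

lemma card_finite_less:
  assumes "finite A"
  shows "|A| <o \<kappa>"
proof -
  have "|A| <o |Field \<kappa>|"
    by (rule finite_ordLess_infinite[OF card_of_Well_order card_of_Well_order])
      (simp_all add: Field_card_of inf assms)
  then show ?thesis using card_of_Field_ordIso[OF card] by (rule ordLess_ordIso_trans)
qed

lemma card_insert_less: "|A| <o \<kappa> \<Longrightarrow> |insert x A| <o \<kappa>"
  using card_of_Un_ordLess_infinite_Field[OF inf card card_finite_less[of "{x}"]] by force

text \<open>If \<open>d\<close> is not definable over \<open>A\<close>, each formula over
  \<open>A\<close> that holds of \<open>d\<close> has a further solution, so the type of
  \<open>d\<close> over \<open>A\<close> is finitely satisfiable by elements other than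
  \<open>d\<close>. Saturation gives such a \<open>c\<close>, and the elementary map that fixes
  \<open>A\<close> and sends \<open>d\<close> to \<open>c\<close> extends to an automorphism that
  moves \<open>d\<close>.\<close>

lemma dclI:
  assumes A: "A \<subseteq> univ L M" "|A| <o \<kappa>" and d: "d \<in> univ L M"
    and fixed: "\<And>\<sigma>. automorphism L M \<sigma> \<Longrightarrow> elementary (graph \<sigma>) \<Longrightarrow> (\<And>x. x \<in> A \<Longrightarrow> \<sigma> x = x) \<Longrightarrow> \<sigma> d = d"
  shows "d \<in> dcl L M A"
proof (rule ccontr)
  assume nd: "d \<notin> dcl L M A"
  define s where "s = sort_of d"
  have s: "s \<in> sorts L" "d \<in> sort_dom M s" using sort_of[OF d] by (auto simp: s_def)
  define v where "v = (0 :: nat, s)"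
  define w where "w = (1 :: nat, s)"
  define \<Sigma> where "\<Sigma> = {pe \<in> param_formulas L M v A. d \<in> solutions M v pe}"
  \<comment> \<open>The inequality has \<open>d\<close> as a parameter, whence the parameter set
    \<open>insert d A\<close> in the appeal to saturation.\<close>
  define ne where "ne = (Neg (Equal (Var v) (Var w)) :: ('s, 'f, 'r) fm, \<lambda>_ :: 's var. d)"
  have sol_ne: "solutions M v ne = sort_dom M s - {d}"
    by (auto simp: ne_def solutions_def v_def w_def)
  \<comment> \<open>Finitely many formulas of the type follow from a single one, to which the
    failure of definability applies.\<close>
  have merge: "\<exists>pe\<in>\<Sigma>. \<forall>c\<in>solutions M v pe. \<forall>pe'\<in>\<Sigma>0. c \<in> solutions M v pe'"
    if "finite \<Sigma>0" "\<Sigma>0 \<subseteq> \<Sigma>" for \<Sigma>0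
    using that
  proof (induction \<Sigma>0 rule: finite_induct)
    case empty
    have "(Neg Falsum, undefined) \<in> \<Sigma>"
      using s by (auto simp: \<Sigma>_def param_formulas_def solutions_def v_def)
    then show ?case by auto
  next
    case (insert pe2 \<Sigma>0)
    then obtain pe1 where "pe1 \<in> \<Sigma>" and pe1: "\<forall>d\<in>solutions M v pe1. \<forall>pe'\<in>\<Sigma>0. d \<in> solutions M v pe'"
      by auto
    then obtain p1 e1 where 1: "pe1 = (p1, e1)" "(p1, e1) \<in> \<Sigma>" by (cases pe1) auto
    obtain p2 e2 where 2: "pe2 = (p2, e2)" "(p2, e2) \<in> \<Sigma>" using insert.prems by (cases pe2) auto
    let ?p = "conj_apart v p1 p2" and ?e = "join_val v e1 e2"
    have sol: "solutions M v (?p, ?e) = solutions M v (p1, e1) \<inter> solutions M v (p2, e2)"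
      unfolding solutions_def by (simp only: prod.case sat_conj_apart) auto
    have "\<forall>u\<in>free_vars ?p - {v}. ?e u \<in> A \<inter> sort_dom M (snd u)"
    proof
      fix u assume u: "u \<in> free_vars ?p - {v}"
      then consider w where "w \<in> free_vars p1 - {v}" "u = apart v 0 w"
        | w where "w \<in> free_vars p2 - {v}" "u = apart v (Suc 0) w"
        unfolding free_vars_apart using apart_eq_iff(1)[of v] by blast
      then show "?e u \<in> A \<inter> sort_dom M (snd u)"
        using 1(2) 2(2) by cases (simp_all add: \<Sigma>_def param_formulas_def join_val_apart)
    qed
    moreover have "?p \<in> formulas L"
      using 1(2) 2(2) by (simp add: \<Sigma>_def param_formulas_def apart_formulas)
    ultimately have "(?p, ?e) \<in> \<Sigma>"
      using 1(2) 2(2) sol unfolding \<Sigma>_def param_formulas_def by blast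
    then show ?case using sol pe1 1(1) 2(1) by blast
  qed
  have "\<exists>c\<in>sort_dom M (snd v). \<forall>pe\<in>insert ne \<Sigma>. c \<in> solutions M v pe"
  proof (rule saturated[unfolded saturated_in_def, rule_format])
    show "insert d A \<subseteq> univ L M" using A d by simp
    show "small \<kappa> (insert d A)"
      unfolding small_def by (rule card_insert_less[OF A(2)])
    show "snd v \<in> sorts L" using s by (simp add: v_def)
    show "insert ne \<Sigma> \<subseteq> param_formulas L M v (insert d A)"
    proof -
      have "\<Sigma> \<subseteq> param_formulas L M v (insert d A)" unfolding \<Sigma>_def param_formulas_def by blast
      moreover have "ne \<in> param_formulas L M v (insert d A)"
        using s by (auto simp: ne_def param_formulas_def v_def w_def)
      ultimately show ?thesis by simp
    qed
    fix \<Sigma>0 assume \<Sigma>0: "finite \<Sigma>0" "\<Sigma>0 \<subseteq> insert ne \<Sigma>"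
    obtain pe where pe: "pe \<in> \<Sigma>" "\<forall>c\<in>solutions M v pe. \<forall>pe'\<in>\<Sigma>0 - {ne}. c \<in> solutions M v pe'"
      using merge[of "\<Sigma>0 - {ne}"] \<Sigma>0 by blast
    have "solutions M v pe \<noteq> {d}"
    proof
      assume "solutions M v pe = {d}"
      moreover have "snd v \<in> sorts L" "pe \<in> param_formulas L M v A"
        using s pe(1) by (simp_all add: v_def \<Sigma>_def)
      ultimately show False using nd unfolding dcl_def by blast
    qed
    then obtain c where c: "c \<in> solutions M v pe" "c \<noteq> d" using pe(1) \<Sigma>_def by blast
    then have "c \<in> sort_dom M (snd v)" by (cases pe) (simp add: solutions_def)
    then show "\<exists>c\<in>sort_dom M (snd v). \<forall>pe\<in>\<Sigma>0. c \<in> solutions M v pe"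
      using pe(2) c sol_ne v_def by (intro bexI[of _ c]) auto
  qed
  then obtain c where c: "c \<in> sort_dom M s" "c \<noteq> d" "\<And>pe. pe \<in> \<Sigma> \<Longrightarrow> c \<in> solutions M v pe"
    using sol_ne v_def by auto
  have "realizes sort_of (\<lambda>p h. sat M h p) (insert (d, c) (Id_on A))"
  proof (rule realizes_insert[OF _ fin_realized_sat _ d, of _ v])
    show "realizes sort_of (\<lambda>p h. sat M h p) (Id_on A)"
      unfolding realizes_def using A sort_of by (auto intro!: sat_cong)
    show "fst ` Id_on A \<subseteq> univ L M" using A by auto
    show "snd v = sort_of d" "fst v = 0" "c \<in> sort_dom M (sort_of d)"
      using c by (simp_all add: v_def s_def)
    fix p h e
    assume p: "p \<in> formulas L" "\<And>u. u \<in> free_vars p - {v} \<Longrightarrow> (h u, e u) \<in> Id_on A"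
      "\<And>u. u \<in> free_vars p - {v} \<Longrightarrow> sort_of (h u) = snd u" "sat M (h(v := d)) p"
    have "h u \<in> A \<inter> sort_dom M (snd u)" if "u \<in> free_vars p - {v}" for u
      using p(2,3)[OF that] A sort_of(2)[of "h u"] by auto
    then have "(p, h) \<in> \<Sigma>"
      using p(1,4) s unfolding \<Sigma>_def param_formulas_def solutions_def v_def by simp
    then have "sat M (h(v := c)) p" using c(3) by (auto simp: solutions_def)
    moreover have "sat M (h(v := c)) p \<longleftrightarrow> sat M (e(v := c)) p"
    proof (rule sat_cong)
      fix u assume "u \<in> free_vars p"
      then show "(h(v := c)) u = (e(v := c)) u" using p(2)[of u] by (cases "u = v") (simp_all add: Id_on_iff)
    qed
    ultimately show "sat M (e(v := c)) p" by simp
  qed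
  then have "elementary (insert (d, c) (Id_on A))"
    using A d by (auto simp: elementary_iff_realizes)
  moreover have "|insert (d, c) (Id_on A)| <o \<kappa>"
  proof -
    have "Id_on A = (\<lambda>x. (x, x)) ` A" by auto
    then have "|Id_on A| <o \<kappa>"
      using ordLeq_ordLess_trans[OF card_of_image A(2), of "\<lambda>x. (x, x)"] by simp
    then show ?thesis by (rule card_insert_less)
  qed
  ultimately obtain \<sigma> where "automorphism L M \<sigma>" "elementary (graph \<sigma>)"
    "\<And>x y. (x, y) \<in> insert (d, c) (Id_on A) \<Longrightarrow> \<sigma> x = y"
    by (rule automorphism_extends) blast
  then show False using fixed[of \<sigma>] c(2) by auto
qed

end

section \<open>Embeddings of linear orders\<close>

text \<open>Strictly increasing maps on a part \<open>G\<close> of an order. They take over from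
  increasing lists because \<open>G\<close> may be infinite and may lie in another order than the
  index set, as in the comparison of tuples along sums of orders.\<close>

definition emb :: "'i rel \<Rightarrow> 'j rel \<Rightarrow> 'i set \<Rightarrow> ('i \<Rightarrow> 'j) \<Rightarrow> bool" where
  "emb r s G \<pi> \<longleftrightarrow> G \<subseteq> Field r \<and> \<pi> ` G \<subseteq> Field s \<and>
     (\<forall>i\<in>G. \<forall>j\<in>G. (i, j) \<in> r \<longrightarrow> i \<noteq> j \<longrightarrow> (\<pi> i, \<pi> j) \<in> s \<and> \<pi> i \<noteq> \<pi> j)"

lemma emb_subset: "emb r s G \<pi> \<Longrightarrow> F \<subseteq> G \<Longrightarrow> emb r s F \<pi>"
  unfolding emb_def by blast

lemma emb_comp: "emb r s G \<pi> \<Longrightarrow> emb s t (\<pi> ` G) \<rho> \<Longrightarrow> emb r t G (\<lambda>i. \<rho> (\<pi> i))"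
  unfolding emb_def by (auto simp: image_subset_iff)

lemma emb_comp_Field:
  assumes "emb r s G \<pi>" "emb s t (Field s) \<rho>"
  shows "emb r t G (\<lambda>i. \<rho> (\<pi> i))"
  using assms by (intro emb_comp[OF assms(1)] emb_subset[OF assms(2)]) (simp add: emb_def)

lemma emb_id: "G \<subseteq> Field r \<Longrightarrow> emb r r G (\<lambda>i. i)"
  by (auto simp: emb_def)

section \<open>Sums of linear orders\<close>

lemma Field_order_sum: "Field (order_sum r s) = Inl ` Field r \<union> Inr ` Field s"
proof
  show "Field (order_sum r s) \<subseteq> Inl ` Field r \<union> Inr ` Field s"
    by (auto simp: order_sum_def Field_def)
  have "Inl i \<in> Field (order_sum r s)" if "i \<in> Field r" for i
  proof -
    from that obtain j where "(i, j) \<in> r \<or> (j, i) \<in> r" by (auto simp: Field_def)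
    then have "(Inl i, Inl j) \<in> order_sum r s \<or> (Inl j, Inl i) \<in> order_sum r s"
      by (auto simp: order_sum_def)
    then show ?thesis by (auto simp: Field_def)
  qed
  moreover have "Inr i \<in> Field (order_sum r s)" if "i \<in> Field s" for i
  proof -
    from that obtain j where "(i, j) \<in> s \<or> (j, i) \<in> s" by (auto simp: Field_def)
    then have "(Inr i, Inr j) \<in> order_sum r s \<or> (Inr j, Inr i) \<in> order_sum r s"
      by (auto simp: order_sum_def)
    then show ?thesis by (auto simp: Field_def)
  qed
  ultimately show "Inl ` Field r \<union> Inr ` Field s \<subseteq> Field (order_sum r s)" by blast
qed

lemma order_sum_simps [simp]:
  "(Inl i, Inl i') \<in> order_sum r s \<longleftrightarrow> (i, i') \<in> r"
  "(Inr j, Inr j') \<in> order_sum r s \<longleftrightarrow> (j, j') \<in> s"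
  "(Inl i, Inr j) \<in> order_sum r s \<longleftrightarrow> i \<in> Field r \<and> j \<in> Field s"
  "(Inr j, Inl i) \<notin> order_sum r s"
  by (auto simp: order_sum_def)

lemma Linear_order_order_sum:
  assumes "Linear_order r" "Linear_order s"
  shows "Linear_order (order_sum r s)"
proof -
  have r: "\<And>i. i \<in> Field r \<Longrightarrow> (i, i) \<in> r" "trans r" "antisym r"
    "\<And>i j. i \<in> Field r \<Longrightarrow> j \<in> Field r \<Longrightarrow> i \<noteq> j \<Longrightarrow> (i, j) \<in> r \<or> (j, i) \<in> r"
    using assms(1) by (auto simp: order_on_defs refl_on_def total_on_def)
  have s: "\<And>i. i \<in> Field s \<Longrightarrow> (i, i) \<in> s" "trans s" "antisym s"
    "\<And>i j. i \<in> Field s \<Longrightarrow> j \<in> Field s \<Longrightarrow> i \<noteq> j \<Longrightarrow> (i, j) \<in> s \<or> (j, i) \<in> s"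
    using assms(2) by (auto simp: order_on_defs refl_on_def total_on_def)
  have F: "(i, j) \<in> r \<Longrightarrow> i \<in> Field r \<and> j \<in> Field r" "(i', j') \<in> s \<Longrightarrow> i' \<in> Field s \<and> j' \<in> Field s"
    for i j i' j' by (auto simp: Field_def)
  have "refl_on (Field (order_sum r s)) (order_sum r s)"
    using r(1) s(1) by (auto simp: refl_on_def Field_order_sum)
  moreover have "order_sum r s \<subseteq> Field (order_sum r s) \<times> Field (order_sum r s)"
    by (auto simp: Field_def)
  moreover have "trans (order_sum r s)"
  proof (rule transI)
    fix x y z assume xy: "(x, y) \<in> order_sum r s" and yz: "(y, z) \<in> order_sum r s"
    show "(x, z) \<in> order_sum r s"
      using xy yz r(2) s(2) F by (cases x; cases y; cases z; simp) (blast dest: transD)+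
  qed
  moreover have "antisym (order_sum r s)"
  proof (rule antisymI)
    fix x y assume xy: "(x, y) \<in> order_sum r s" and yx: "(y, x) \<in> order_sum r s"
    show "x = y"
      using xy yx r(3) s(3) by (cases x; cases y; simp) (blast dest: antisymD)+
  qed
  moreover have "total_on (Field (order_sum r s)) (order_sum r s)"
    unfolding total_on_def
  proof (intro ballI impI)
    fix x y assume "x \<in> Field (order_sum r s)" "y \<in> Field (order_sum r s)" "x \<noteq> y"
    then show "(x, y) \<in> order_sum r s \<or> (y, x) \<in> order_sum r s"
      using r(4) s(4) unfolding Field_order_sum by (cases x; cases y; simp add: image_iff; blast)
  qed
  ultimately show ?thesis
    by (simp add: order_on_defs)
qed

lemma emb_Inl: "G \<subseteq> Field r \<Longrightarrow> emb r (order_sum r s) G Inl"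
  and emb_Inr: "H \<subseteq> Field s \<Longrightarrow> emb s (order_sum r s) H Inr"
  by (auto simp: emb_def Field_order_sum)

lemma emb_map_sum:
  assumes "emb r r' G \<pi>" "emb s s' H \<rho>"
  shows "emb (order_sum r s) (order_sum r' s') (Inl ` G \<union> Inr ` H) (map_sum \<pi> \<rho>)"
  using assms unfolding emb_def Field_order_sum by (auto simp: image_subset_iff)

section \<open>Increasing lists and embeddings of finite sets\<close>

lemma increasing_distinct: "increasing r is \<Longrightarrow> distinct is"
  by (induction "is") (auto simp: increasing_def)

lemma increasing_map:
  assumes "emb r s G \<pi>" "increasing r is" "set is \<subseteq> G"
  shows "increasing s (map \<pi> is)"
proof -
  have "sorted_wrt (\<lambda>i j. (\<pi> i, \<pi> j) \<in> s \<and> \<pi> i \<noteq> \<pi> j) is"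
    by (rule sorted_wrt_mono_rel[of _ "\<lambda>i j. (i, j) \<in> r \<and> i \<noteq> j"])
      (use assms in \<open>auto simp: emb_def increasing_def subset_iff\<close>)
  moreover have "\<pi> ` set is \<subseteq> Field s" using assms by (auto simp: emb_def)
  ultimately show ?thesis by (simp add: increasing_def sorted_wrt_map)
qed

lemma finite_increasing_list:
  assumes r: "Linear_order r" and "finite F" "F \<subseteq> Field r"
  obtains "is" where "increasing r is" "set is = F"
proof -
  have "\<exists>is. increasing r is \<and> set is = F"
    using assms(2,3)
  proof (induction F rule: finite_induct)
    case empty
    then show ?case by (intro exI[of _ "[]"]) (simp add: increasing_def)
  next
    case (insert x F)
    then obtain "is" where is': "increasing r is" "set is = F" by auto
    let ?is = "filter (\<lambda>y. (y, x) \<in> r) is @ x # filter (\<lambda>y. (x, y) \<in> r) is"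
    have tr: "trans r" "antisym r" "\<And>y. y \<in> F \<Longrightarrow> (x, y) \<in> r \<or> (y, x) \<in> r"
      using r insert by (auto simp: order_on_defs total_on_def)
    have "(y, z) \<in> r \<and> y \<noteq> z" if "y \<in> F" "(y, x) \<in> r" "(x, z) \<in> r" for y z
      using tr(1,2) that insert(2) by (metis antisymD transD)
    then have "increasing r ?is"
      using is' insert by (auto simp: increasing_def sorted_wrt_append intro: sorted_wrt_filter)
    moreover have "set ?is = insert x F" using is' tr(3) by auto
    ultimately show ?case by blast
  qed
  then show ?thesis using that by blast
qed

lemma emb_of_increasing_lists:
  assumes r: "Linear_order r"
    and inc: "increasing r is" "increasing s js" "length is = length js"
  obtains \<pi> where "emb r s (set is) \<pi>"
proof
  define \<pi> where "\<pi> i = the (map_of (zip is js) i)" for i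
  have \<pi>: "\<pi> (is ! k) = js ! k" if "k < length is" for k
    using map_of_zip_nth[OF inc(3) increasing_distinct[OF inc(1)]] that inc(3) by (simp add: \<pi>_def)
  have "(\<pi> i, \<pi> j) \<in> s \<and> \<pi> i \<noteq> \<pi> j" if ij: "i \<in> set is" "j \<in> set is" "(i, j) \<in> r" "i \<noteq> j" for i j
  proof -
    obtain k l where kl: "k < length is" "l < length is" "i = is ! k" "j = is ! l"
      using ij(1,2) by (metis in_set_conv_nth)
    have "\<not> l < k"
    proof
      assume "l < k"
      then have "(j, i) \<in> r"
        using sorted_wrt_nth_less[of "\<lambda>i j. (i, j) \<in> r \<and> i \<noteq> j" "is" l k] inc(1) kl
        by (simp add: increasing_def)
      then show False using ij(3,4) r by (auto simp: order_on_defs dest: antisymD)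
    qed
    then have "k < l" using kl ij(4) by (metis linorder_neqE_nat)
    then show ?thesis
      using sorted_wrt_nth_less[of "\<lambda>i j. (i, j) \<in> s \<and> i \<noteq> j" js k l] inc(2,3) kl \<pi>
      by (simp add: increasing_def)
  qed
  moreover have "\<pi> ` set is \<subseteq> Field s"
    using \<pi> inc(2,3) by (force simp: increasing_def in_set_conv_nth subset_iff)
  ultimately show "emb r s (set is) \<pi>"
    using inc(1) by (simp add: emb_def increasing_def)
qed

text \<open>Every finite order type occurs in every infinite linear order. This allows
  configurations in a sum of orders to be copied into a single given sequence.\<close>

lemma emb_exists:
  assumes "Linear_order r" "finite G" "G \<subseteq> Field r" "Linear_order s" "infinite (Field s)"
  obtains \<pi> where "emb r s G \<pi>"
proof -
  obtain "is" where is': "increasing r is" "set is = G"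
    using finite_increasing_list[OF assms(1-3)] .
  obtain H where H: "H \<subseteq> Field s" "finite H" "card H = card G"
    using infinite_arbitrarily_large[OF assms(5)] by blast
  obtain js where js: "increasing s js" "set js = H"
    using finite_increasing_list[OF assms(4) H(2,1)] .
  have "length is = length js"
    using is' js H(3) distinct_card increasing_distinct by metis
  from emb_of_increasing_lists[OF assms(1) is'(1) js(1) this] that is'(2) show ?thesis by blast
qed

section \<open>Types and indiscernible sequences\<close>

text \<open>Relabels the type variables along \<open>\<phi>\<close> and leaves the parameters alone;
  \<open>\<phi>\<close> may identify labels.\<close>

lemma tp_transfer:
  assumes sub: "tp L M C Y' f' \<subseteq> tp L M C Y' g'" and \<phi>: "\<phi> ` Y \<subseteq> Y'"
    and f: "\<And>y. y \<in> Y \<Longrightarrow> f y = f' (\<phi> y)" and g: "\<And>y. y \<in> Y \<Longrightarrow> g y = g' (\<phi> y)"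
  shows "tp L M C Y f \<subseteq> tp L M C Y g"
proof
  fix z assume z: "z \<in> tp L M C Y f"
  obtain p h where ph: "z = (p, h)" by (rule prod.exhaust)
  have p: "p \<in> formulas L" and h: "\<And>u. u \<in> free_vars p \<Longrightarrow> h u \<in> Y <+> C"
    and srt: "\<And>u. u \<in> free_vars p \<Longrightarrow> case_sum f id (h u) \<in> sort_dom M (snd u)"
    and sat: "sat M (case_sum f id \<circ> h) p"
    using z by (auto simp: ph tp_def)
  define h' where "h' = map_sum \<phi> id \<circ> h"
  have h': "h' u \<in> Y' <+> C" "case_sum f id (h u) = case_sum f' id (h' u)"
    "case_sum g id (h u) = case_sum g' id (h' u)" if "u \<in> free_vars p" for u
    using h[OF that] \<phi> f g by (auto simp: h'_def)
  have "sat M (case_sum f' id \<circ> h') p"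
    by (rule sat_cong[THEN iffD1, OF _ sat]) (use h' in simp)
  then have "(p, h') \<in> tp L M C Y' f'"
    using p h' srt by (simp add: tp_def)
  then have "(p, h') \<in> tp L M C Y' g'" using sub by blast
  then have sat': "sat M (case_sum g' id \<circ> h') p"
    and srt': "\<And>u. u \<in> free_vars p \<Longrightarrow> case_sum g' id (h' u) \<in> sort_dom M (snd u)"
    by (auto simp: tp_def)
  have "sat M (case_sum g id \<circ> h) p"
    by (rule sat_cong[THEN iffD1, OF _ sat']) (use h' in simp)
  then show "z \<in> tp L M C Y g"
    using p h h' srt' by (simp add: tp_def ph)
qed

lemma tp_cong:
  assumes "\<And>y. y \<in> Y \<Longrightarrow> f y = g y"
  shows "tp L M C Y f = tp L M C Y g"
proof (rule subset_antisym)
  show "tp L M C Y f \<subseteq> tp L M C Y g"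
    by (rule tp_transfer[of L M C Y g g "\<lambda>y. y"]) (simp_all add: assms)
  show "tp L M C Y g \<subseteq> tp L M C Y f"
    by (rule tp_transfer[of L M C Y f f "\<lambda>y. y"]) (simp_all add: assms)
qed

text \<open>A formula mentions finitely many indices. Only the index side is cut down to a finite
  set; the component set \<open>X\<close> stays whole, as in the definition of
  indiscernibility.\<close>

lemma tp_finite:
  assumes "\<And>F. finite F \<Longrightarrow> F \<subseteq> G \<Longrightarrow> tp L M C (F \<times> X) f \<subseteq> tp L M C (F \<times> X) g"
  shows "tp L M C (G \<times> X) f \<subseteq> tp L M C (G \<times> X) g"
proof
  fix z assume z: "z \<in> tp L M C (G \<times> X) f"
  obtain p h where ph: "z = (p, h)" by (rule prod.exhaust)
  define F where "F = {i \<in> G. \<exists>u\<in>free_vars p. \<exists>x. h u = Inl (i, x)}"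
  have "F \<subseteq> (\<lambda>u. fst (projl (h u))) ` free_vars p"
    unfolding F_def by force
  then have "finite F"
    by (rule finite_subset) (simp add: finite_free_vars)
  moreover have "F \<subseteq> G" by (auto simp: F_def)
  ultimately have F: "finite F" "F \<subseteq> G" .
  have "h u \<in> F \<times> X <+> C" if "u \<in> free_vars p" for u
  proof -
    have "h u \<in> G \<times> X <+> C" using z that by (auto simp: ph tp_def)
    then show ?thesis using that unfolding F_def by (cases "h u") force+
  qed
  then have "z \<in> tp L M C (F \<times> X) f" using z by (simp add: ph tp_def)
  then have "z \<in> tp L M C (F \<times> X) g" using assms[OF F] by blast
  then show "z \<in> tp L M C (G \<times> X) g" using F(2) by (fastforce simp: ph tp_def)
qed

lemma indiscernible_tp:
  assumes "indiscernible_over L M X C r a" "increasing r is" "increasing r js" "length is = length js"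
  shows "tp L M C ({..<length is} \<times> X) (\<lambda>(k, x). a (is ! k) x) =
    tp L M C ({..<length js} \<times> X) (\<lambda>(k, x). a (js ! k) x)"
  using assms(1)[unfolded indiscernible_over_def, THEN conjunct2, THEN conjunct2, THEN conjunct2]
    assms(2-4) by (elim allE impE)

text \<open>The working form of indiscernibility. By \<open>tp_finite\<close> a finite part of
  \<open>G\<close> suffices; listed in increasing order, it is sent by both embeddings to increasing
  lists of \<open>r\<close>, to which the definition applies.\<close>

lemma indiscernible_emb:
  assumes a: "indiscernible_over L M X C r a" and t: "Linear_order t"
    and emb: "emb t r G \<pi>" "emb t r G \<rho>"
  shows "tp L M C (G \<times> X) (\<lambda>(i, x). a (\<pi> i) x) \<subseteq> tp L M C (G \<times> X) (\<lambda>(i, x). a (\<rho> i) x)"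
proof (rule tp_finite)
  fix F assume F: "finite F" "F \<subseteq> G"
  then have "F \<subseteq> Field t" using emb(1) by (auto simp: emb_def)
  then obtain "is" where is': "increasing t is" "set is = F"
    using finite_increasing_list[OF t F(1)] by blast
  have inc: "increasing r (map \<pi> is)" "increasing r (map \<rho> is)"
    using increasing_map[OF emb(1) is'(1)] increasing_map[OF emb(2) is'(1)] is'(2) F by auto
  \<comment> \<open>The position of an index in the list translates tuples indexed by positions back
    into tuples indexed by \<open>F\<close>.\<close>
  define idx where "idx i = (SOME k. k < length is \<and> is ! k = i)" for i
  have idx: "idx i < length is" "is ! idx i = i" if "i \<in> F" for i
    using that is'(2) someI_ex[of "\<lambda>k. k < length is \<and> is ! k = i"]
    by (auto simp: idx_def in_set_conv_nth)
  show "tp L M C (F \<times> X) (\<lambda>(i, x). a (\<pi> i) x) \<subseteq> tp L M C (F \<times> X) (\<lambda>(i, x). a (\<rho> i) x)"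
  proof (rule tp_transfer)
    show "tp L M C ({..<length is} \<times> X) (\<lambda>(k, x). a (map \<pi> is ! k) x) \<subseteq>
        tp L M C ({..<length is} \<times> X) (\<lambda>(k, x). a (map \<rho> is ! k) x)"
      using indiscernible_tp[OF a inc] by simp
    show "(\<lambda>(i, x). (idx i, x)) ` (F \<times> X) \<subseteq> {..<length is} \<times> X" using idx by auto
  qed (use idx in auto)
qed

text \<open>An increasing list is an embedding of an initial segment of the natural numbers. One
  inclusion is enough because \<open>\<pi>\<close> and \<open>\<rho>\<close> may be
  exchanged.\<close>

lemma indiscernible_overI:
  assumes r: "Linear_order r" "infinite (Field r)"
    and a: "\<And>i x. i \<in> Field r \<Longrightarrow> x \<in> X \<Longrightarrow> a i x \<in> univ L M"
    and tp: "\<And>n \<pi> \<rho>. emb natLeq r {..<n} \<pi> \<Longrightarrow> emb natLeq r {..<n} \<rho> \<Longrightarrow>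
       tp L M C ({..<n} \<times> X) (\<lambda>(k, x). a (\<pi> k) x) \<subseteq> tp L M C ({..<n} \<times> X) (\<lambda>(k, x). a (\<rho> k) x)"
  shows "indiscernible_over L M X C r a"
proof -
  have emb: "emb natLeq r {..<length is} ((!) is)" if "increasing r is" for "is"
    unfolding emb_def
  proof (intro conjI ballI impI)
    show "{..<length is} \<subseteq> Field natLeq" by (simp add: Field_natLeq)
    show "(!) is ` {..<length is} \<subseteq> Field r" using that by (auto simp: increasing_def)
    fix i j assume "i \<in> {..<length is}" "j \<in> {..<length is}" "(i, j) \<in> natLeq" "i \<noteq> j"
    then show "(is ! i, is ! j) \<in> r" "is ! i \<noteq> is ! j"
      using sorted_wrt_nth_less[of "\<lambda>i j. (i, j) \<in> r \<and> i \<noteq> j" "is" i j] that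
      by (auto simp: increasing_def natLeq_def)
  qed
  show ?thesis
    unfolding indiscernible_over_def
  proof (intro conjI allI impI ballI r a)
    fix "is" js assume inc: "increasing r is" "increasing r js" "length is = length js"
    show "tp L M C ({..<length is} \<times> X) (\<lambda>(k, x). a (is ! k) x) =
        tp L M C ({..<length js} \<times> X) (\<lambda>(k, x). a (js ! k) x)"
      using tp[OF emb[OF inc(1)]] tp[OF emb[OF inc(2)]] emb[OF inc(1)] emb[OF inc(2)] inc(3)
      by (simp add: subset_antisym)
  qed
qed

lemma indiscernible_overD:
  assumes "indiscernible_over L M X C r a"
  shows "Linear_order r" "infinite (Field r)" "i \<in> Field r \<Longrightarrow> x \<in> X \<Longrightarrow> a i x \<in> univ L M"
  using assms by (auto simp: indiscernible_over_def)

lemma indiscernible_cong: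
  assumes a: "indiscernible_over L M X C r a"
    and eq: "\<And>i x. i \<in> Field r \<Longrightarrow> x \<in> X \<Longrightarrow> a' i x = a i x"
  shows "indiscernible_over L M X C r a'"
proof (rule indiscernible_overI)
  show "a' i x \<in> univ L M" if "i \<in> Field r" "x \<in> X" for i x
    using indiscernible_overD(3)[OF a that] eq[OF that] by simp
next
  fix n \<pi> \<rho> assume emb: "emb natLeq r {..<n} \<pi>" "emb natLeq r {..<n} \<rho>"
  have "tp L M C ({..<n} \<times> X) (\<lambda>(k, x). a' (\<pi> k) x) = tp L M C ({..<n} \<times> X) (\<lambda>(k, x). a (\<pi> k) x)"
    "tp L M C ({..<n} \<times> X) (\<lambda>(k, x). a' (\<rho> k) x) = tp L M C ({..<n} \<times> X) (\<lambda>(k, x). a (\<rho> k) x)"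
    using emb eq by (auto simp: emb_def intro!: tp_cong)
  then show "tp L M C ({..<n} \<times> X) (\<lambda>(k, x). a' (\<pi> k) x) \<subseteq> tp L M C ({..<n} \<times> X) (\<lambda>(k, x). a' (\<rho> k) x)"
    using indiscernible_emb[OF a natLeq_Linear_order emb] by simp
qed (use indiscernible_overD[OF a] in auto)

lemma indiscernible_subsequence:
  assumes c: "indiscernible_over L M X C t c" and r: "Linear_order r" "infinite (Field r)"
    and \<iota>: "emb r t (Field r) \<iota>" and eq: "\<And>i x. i \<in> Field r \<Longrightarrow> x \<in> X \<Longrightarrow> a i x = c (\<iota> i) x"
  shows "indiscernible_over L M X C r a"
proof (rule indiscernible_cong[where a = "\<lambda>i. c (\<iota> i)"])
  show "indiscernible_over L M X C r (\<lambda>i. c (\<iota> i))"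
  proof (rule indiscernible_overI[OF r])
    show "c (\<iota> i) x \<in> univ L M" if "i \<in> Field r" "x \<in> X" for i x
      using indiscernible_overD(3)[OF c _ that(2)] \<iota> that(1) by (auto simp: emb_def)
    fix n \<pi> \<rho> assume emb: "emb natLeq r {..<n} \<pi>" "emb natLeq r {..<n} \<rho>"
    have "emb natLeq t {..<n} (\<lambda>k. \<iota> (\<pi> k))" "emb natLeq t {..<n} (\<lambda>k. \<iota> (\<rho> k))"
      using emb \<iota> by (simp_all add: emb_comp_Field)
    from indiscernible_emb[OF c natLeq_Linear_order this]
    show "tp L M C ({..<n} \<times> X) (\<lambda>(k, x). c (\<iota> (\<pi> k)) x) \<subseteq> tp L M C ({..<n} \<times> X) (\<lambda>(k, x). c (\<iota> (\<rho> k)) x)" .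
  qed
qed (use eq in auto)

lemma cleanly_collinearI:
  assumes c: "indiscernible_over L M X {} (order_sum r s) (case_sum a b)"
    and rs: "Linear_order r" "infinite (Field r)" "Linear_order s" "infinite (Field s)"
  shows "cleanly_collinear L M X (r, a) (s, b)" "cleanly_collinear L M X (s, b) (r, a)"
proof -
  have "indiscernible_over L M X {} r a"
    by (rule indiscernible_subsequence[OF c rs(1,2) emb_Inl]) auto
  moreover have "indiscernible_over L M X {} s b"
    by (rule indiscernible_subsequence[OF c rs(3,4) emb_Inr]) auto
  ultimately show "cleanly_collinear L M X (r, a) (s, b)" "cleanly_collinear L M X (s, b) (r, a)"
    using c by (simp_all add: cleanly_collinear_def)
qed

context big_model begin

section \<open>Continuing an indiscernible sequence\<close>

lemma card_Times_less:
  assumes "|A| <o \<kappa>" "|B| <o \<kappa>"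
  shows "|A \<times> B| <o \<kappa>"
proof (cases "finite (A <+> B)")
  case True
  then show ?thesis by (intro card_finite_less) simp
next
  case False
  have "|A \<times> B| \<le>o |(A <+> B) \<times> B|" by (rule card_of_Times_mono1[OF card_of_Plus1])
  also have "|(A <+> B) \<times> B| \<le>o |(A <+> B) \<times> (A <+> B)|" by (rule card_of_Times_mono2[OF card_of_Plus2])
  also have "|(A <+> B) \<times> (A <+> B)| =o |A <+> B|" by (rule card_of_Times_same_infinite[OF False])
  also have "|A <+> B| <o \<kappa>" by (rule card_of_Plus_ordLess_infinite_Field[OF inf card assms])
  finally show ?thesis .
qed

lemma card_image_less: "|A| <o \<kappa> \<Longrightarrow> |f ` A| <o \<kappa>"
  by (rule ordLeq_ordLess_trans[OF card_of_image])

lemma card_Un_less: "|A| <o \<kappa> \<Longrightarrow> |B| <o \<kappa> \<Longrightarrow> |A \<union> B| <o \<kappa>"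
  by (rule card_of_Un_ordLess_infinite_Field[OF inf card])

lemma realize_all:
  assumes Y: "fin_realized srt Th Y" "|Y| <o \<kappa>"
    and R0: "realizes srt Th R0" "|R0| <o \<kappa>" "fst ` R0 \<subseteq> Y"
  shows "\<exists>R. R0 \<subseteq> R \<and> realizes srt Th R \<and> (\<forall>y\<in>Y. \<exists>x. (y, x) \<in> R)"
proof -
  have "\<exists>R. R0 \<subseteq> R \<and> (fst ` R \<subseteq> Y \<and> realizes srt Th R) \<and> (\<forall>y\<in>Y. \<exists>q\<in>R. fst q = y)"
  proof (rule transfinite_solution[OF card inf, of Y "\<lambda>R. fst ` R \<subseteq> Y \<and> realizes srt Th R" "\<lambda>y q. fst q = y" R0])
    show "|Y| \<le>o \<kappa>" using Y(2) by (rule ordLess_imp_ordLeq)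
    show "fst ` R \<subseteq> Y \<and> realizes srt Th R \<longleftrightarrow>
        (\<forall>F. finite F \<longrightarrow> F \<subseteq> R \<longrightarrow> fst ` F \<subseteq> Y \<and> realizes srt Th F)" for R
    proof -
      have "fst ` R \<subseteq> Y \<longleftrightarrow> (\<forall>F. finite F \<longrightarrow> F \<subseteq> R \<longrightarrow> fst ` F \<subseteq> Y)"
      proof
        assume *: "\<forall>F. finite F \<longrightarrow> F \<subseteq> R \<longrightarrow> fst ` F \<subseteq> Y"
        have "fst q \<in> Y" if "q \<in> R" for q using *[rule_format, of "{q}"] that by simp
        then show "fst ` R \<subseteq> Y" by blast
      qed blast
      then show ?thesis using realizes_fin_char[of srt Th R] by meson
    qed
    show "\<exists>q. (fst ` insert q R \<subseteq> Y \<and> realizes srt Th (insert q R)) \<and> fst q = y"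
      if R: "fst ` R \<subseteq> Y \<and> realizes srt Th R" "|R| <o \<kappa>" "y \<in> Y" for R y
    proof -
      have "fst ` R \<subseteq> Y" "realizes srt Th R" using R(1) by simp_all
      from realize_one[OF Y(1) this(1) R(3) this(2) R(2)]
      obtain d where "realizes srt Th (insert (y, d) R)" by blast
      then show ?thesis using R by (intro exI[of _ "(y, d)"]) simp
    qed
  qed (use R0 in blast)+
  then obtain R where R: "R0 \<subseteq> R" "realizes srt Th R" "\<forall>y\<in>Y. \<exists>q\<in>R. fst q = y" by blast
  have "\<exists>x. (y, x) \<in> R" if "y \<in> Y" for y
  proof -
    obtain q where "q \<in> R" "fst q = y" using R(3) \<open>y \<in> Y\<close> by blast
    then show ?thesis by (cases q) auto
  qed
  then show ?thesis using R by blast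
qed

section \<open>Types compared through elementary relations and elementary maps\<close>

lemma tp_sort:
  assumes "tp L M C Y f \<subseteq> tp L M C Y g" "y \<in> Y" "s \<in> sorts L" "f y \<in> sort_dom M s"
  shows "g y \<in> sort_dom M s"
proof -
  \<comment> \<open>The trivial equation in a variable of sort \<open>s\<close> records that the
    component has sort \<open>s\<close>.\<close>
  have "(Equal (Var (0, s)) (Var (0, s)), \<lambda>_. Inl y) \<in> tp L M C Y f"
    using assms(2-4) by (simp add: tp_def InlI)
  then have "(Equal (Var (0, s)) (Var (0, s)), \<lambda>_. Inl y) \<in> tp L M C Y g"
    using assms(1) by blast
  then show ?thesis by (simp add: tp_def)
qed

text \<open>For labels of the right sorts a type contains \<open>p\<close> or its negation, so one
  inclusion already gives an equivalence.\<close>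

lemma sat_of_tp_subset:
  assumes sub: "tp L M {} Y f \<subseteq> tp L M {} Y g" and p: "p \<in> formulas L"
    and l: "\<And>u. u \<in> free_vars p \<Longrightarrow> l u \<in> Y \<and> f (l u) \<in> sort_dom M (snd u)"
  shows "sat M (\<lambda>u. f (l u)) p \<longleftrightarrow> sat M (\<lambda>u. g (l u)) p"
proof -
  have comp: "case_sum k id \<circ> (\<lambda>u. Inl (l u)) = (\<lambda>u. k (l u))" for k :: "'b \<Rightarrow> 'a" by auto
  have "(p, \<lambda>u. Inl (l u)) \<in> tp L M {} Y f \<longleftrightarrow> sat M (\<lambda>u. f (l u)) p"
    using p l by (simp add: tp_def comp InlI)
  moreover have "(Neg p, \<lambda>u. Inl (l u)) \<in> tp L M {} Y f \<longleftrightarrow> \<not> sat M (\<lambda>u. f (l u)) p"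
    using p l by (simp add: tp_def comp InlI)
  moreover have "sat M (\<lambda>u. g (l u)) p" if "(p, \<lambda>u. Inl (l u)) \<in> tp L M {} Y g"
    using that by (simp add: tp_def comp)
  moreover have "\<not> sat M (\<lambda>u. g (l u)) p" if "(Neg p, \<lambda>u. Inl (l u)) \<in> tp L M {} Y g"
    using that by (simp add: tp_def comp)
  ultimately show ?thesis using sub by blast
qed

lemma elementary_of_tp:
  assumes sub: "tp L M {} Y f \<subseteq> tp L M {} Y g" and f: "\<And>y. y \<in> Y \<Longrightarrow> f y \<in> univ L M"
  shows "elementary ((\<lambda>y. (f y, g y)) ` Y)"
  unfolding elementary_def
proof (intro conjI ballI allI impI)
  fix z assume "z \<in> (\<lambda>y. (f y, g y)) ` Y"
  then obtain y where y: "z = (f y, g y)" "y \<in> Y" by blast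
  note s = sort_of[OF f[OF y(2)]]
  have "g y \<in> sort_dom M (sort_of (f y))" by (rule tp_sort[OF sub y(2) s])
  then show "case z of (x, y) \<Rightarrow> x \<in> univ L M \<and> y \<in> univ L M \<and> sort_of x = sort_of y"
    using y f s(1) sort_dom_univ sort_of_eq by simp
next
  fix p e e'
  assume p: "p \<in> formulas L"
    and e: "\<forall>u\<in>free_vars p. (e u, e' u) \<in> (\<lambda>y. (f y, g y)) ` Y \<and> e u \<in> sort_dom M (snd u)"
  \<comment> \<open>\<open>f\<close> and \<open>g\<close> may repeat values, so each free variable
    is given one label that accounts for both entries of its pair.\<close>
  define l where "l u = (SOME y. y \<in> Y \<and> (e u, e' u) = (f y, g y))" for u
  have l: "l u \<in> Y \<and> (e u, e' u) = (f (l u), g (l u))" if "u \<in> free_vars p" for u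
    unfolding l_def by (rule someI_ex) (use e that in blast)
  have "sat M e p \<longleftrightarrow> sat M (\<lambda>u. f (l u)) p"
    by (rule sat_cong) (use l in simp)
  also have "\<dots> \<longleftrightarrow> sat M (\<lambda>u. g (l u)) p"
    by (rule sat_of_tp_subset[OF sub p]) (use l e in auto)
  also have "\<dots> \<longleftrightarrow> sat M e' p"
    by (rule sat_cong) (use l in simp)
  finally show "sat M e p \<longleftrightarrow> sat M e' p" .
qed

lemma tp_elementary_map:
  assumes \<sigma>: "elementary (graph \<sigma>)" and f: "\<And>y. y \<in> Y \<Longrightarrow> f y \<in> univ L M"
  shows "tp L M {} Y (\<lambda>y. \<sigma> (f y)) = tp L M {} Y f"
proof -
  have srt: "\<sigma> x \<in> sort_dom M s \<longleftrightarrow> x \<in> sort_dom M s" if x: "x \<in> univ L M" and s: "s \<in> sorts L" for x s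
  proof
    assume "\<sigma> x \<in> sort_dom M s"
    moreover have "\<sigma> x \<in> sort_dom M (sort_of x)"
      by (rule elementary_map_sort[OF \<sigma> sort_of[OF x]])
    ultimately have "sort_of x = s" using sort_unique[OF sort_of(1)[OF x] s] by simp
    then show "x \<in> sort_dom M s" using sort_of(2)[OF x] by simp
  qed (rule elementary_map_sort[OF \<sigma> s])
  have "(p, h) \<in> tp L M {} Y (\<lambda>y. \<sigma> (f y)) \<longleftrightarrow> (p, h) \<in> tp L M {} Y f" for p h
  proof (cases "p \<in> formulas L \<and> (\<forall>u\<in>free_vars p. h u \<in> Y <+> {} \<and> case_sum f id (h u) \<in> sort_dom M (snd u))")
    case True
    have eq: "case_sum (\<lambda>y. \<sigma> (f y)) id (h u) = \<sigma> (case_sum f id (h u))" if "u \<in> free_vars p" for u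
      using True that by auto
    have "sat M (case_sum (\<lambda>y. \<sigma> (f y)) id \<circ> h) p \<longleftrightarrow> sat M (\<sigma> \<circ> (case_sum f id \<circ> h)) p"
      by (rule sat_cong) (simp add: eq)
    also have "\<dots> \<longleftrightarrow> sat M (case_sum f id \<circ> h) p"
      by (rule sat_elementary_map[OF \<sigma>]) (use True in auto)
    finally show ?thesis
      using True eq elementary_map_sort[OF \<sigma>] free_var_sort[of p L] by (simp add: tp_def)
  next
    case False
    have "case_sum f id (h u) \<in> sort_dom M (snd u)"
      if "p \<in> formulas L" "u \<in> free_vars p" "h u \<in> Y <+> {}" "case_sum (\<lambda>y. \<sigma> (f y)) id (h u) \<in> sort_dom M (snd u)" for u
      using that srt[OF f free_var_sort[OF that(1,2)]] by auto
    then show ?thesis using False unfolding tp_def by blast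
  qed
  then show ?thesis by auto
qed

lemma indiscernible_elementary_map:
  assumes \<sigma>: "elementary (graph \<sigma>)" and c: "indiscernible_over L M X {} t c"
  shows "indiscernible_over L M X {} t (\<lambda>i x. \<sigma> (c i x))"
proof (rule indiscernible_overI)
  show "\<sigma> (c i x) \<in> univ L M" if "i \<in> Field t" "x \<in> X" for i x
  proof -
    have "c i x \<in> univ L M" using indiscernible_overD(3)[OF c that] .
    then have "\<sigma> (c i x) \<in> sort_dom M (sort_of (c i x))" "sort_of (c i x) \<in> sorts L"
      using elementary_map_sort[OF \<sigma>] sort_of by auto
    then show ?thesis by (rule sort_dom_univ[rotated])
  qed
  fix n \<pi> \<rho> assume emb: "emb natLeq t {..<n} \<pi>" "emb natLeq t {..<n} \<rho>"
  have *: "tp L M {} ({..<n} \<times> X) (\<lambda>(k, x). \<sigma> (c (\<pi> k) x)) = tp L M {} ({..<n} \<times> X) (\<lambda>(k, x). c (\<pi> k) x)"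
    if "emb natLeq t {..<n} \<pi>" for \<pi>
  proof -
    have "(case y of (k, x) \<Rightarrow> c (\<pi> k) x) \<in> univ L M" if "y \<in> {..<n} \<times> X" for y
      using \<open>emb natLeq t {..<n} \<pi>\<close> that by (auto simp: emb_def intro!: indiscernible_overD(3)[OF c])
    from tp_elementary_map[OF \<sigma> this] show ?thesis by (simp add: case_prod_unfold)
  qed
  show "tp L M {} ({..<n} \<times> X) (\<lambda>(k, x). \<sigma> (c (\<pi> k) x)) \<subseteq> tp L M {} ({..<n} \<times> X) (\<lambda>(k, x). \<sigma> (c (\<rho> k) x))"
    unfolding *[OF emb(1)] *[OF emb(2)] by (rule indiscernible_emb[OF c natLeq_Linear_order emb])
qed (use indiscernible_overD[OF c] in auto)

text \<open>\<open>Th\<close> is the Ehrenfeucht-Mostowski type of \<open>a\<close>, spread over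
  \<open>order_sum r r\<close>. On the left copy \<open>a\<close> realizes it; completing this
  partial realization yields \<open>b\<close>. The completed sequence is indiscernible because each
  of its tuples has the type of an increasing tuple of \<open>a\<close>.\<close>

lemma continuation_exists:
  fixes r :: "'i rel" and a :: "'i \<Rightarrow> 'x \<Rightarrow> 'a"
  assumes a: "indiscernible_over L M X {} r a" and small: "|Field r| <o \<kappa>" "|X| <o \<kappa>"
  obtains b where "indiscernible_over L M X {} (order_sum r r) (case_sum a b)"
proof -
  define t where "t = order_sum r r"
  have r: "Linear_order r" "infinite (Field r)" using indiscernible_overD[OF a] by auto
  have t: "Linear_order t" unfolding t_def by (rule Linear_order_order_sum[OF r(1) r(1)])
  have inft: "infinite (Field t)"
    unfolding t_def Field_order_sum using r(2) by (simp add: finite_image_iff)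
  define Y where "Y = Field t \<times> X"
  obtain i0 where i0: "i0 \<in> Field r" using r(2) by fastforce
  \<comment> \<open>All members of \<open>a\<close> agree in the sorts of their components, so the
    single index \<open>i0\<close> serves as a sample.\<close>
  define srt where "srt y = sort_of (a i0 (snd y))" for y :: "('i + 'i) \<times> 'x"
  define val where "val \<pi> h = (\<lambda>u. a (\<pi> (fst (h u))) (snd (h u)))"
    for \<pi> :: "'i + 'i \<Rightarrow> 'i" and h :: "'s var \<Rightarrow> ('i + 'i) \<times> 'x"
  \<comment> \<open>By indiscernibility the choice of \<open>\<pi>\<close> does not matter, which is
    the content of \<open>Th_iff\<close>.\<close>
  define Th where "Th p h \<longleftrightarrow> (\<exists>\<pi>. emb t r (fst ` h ` free_vars p) \<pi> \<and> sat M (val \<pi> h) p)"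
    for p :: "('s, 'f, 'r) fm" and h
  have srt_a: "srt (j, x) \<in> sorts L \<and> a i x \<in> sort_dom M (srt (j, x))" if i: "i \<in> Field r" and x: "x \<in> X" for i j x
  proof -
    have "tp L M {} ({i0} \<times> X) (\<lambda>(k, x). a k x) \<subseteq> tp L M {} ({i0} \<times> X) (\<lambda>(k, x). a i x)"
      by (rule indiscernible_emb[OF a r(1)]) (use i i0 in \<open>auto simp: emb_def\<close>)
    from tp_sort[OF this, of "(i0, x)"] show ?thesis
      using sort_of[OF indiscernible_overD(3)[OF a i0 x]] x by (simp add: srt_def)
  qed
  have Th_iff: "Th p h \<longleftrightarrow> sat M (val \<pi> h) p"
    if p: "p \<in> formulas L" and h: "\<forall>u\<in>free_vars p. h u \<in> G \<times> X \<and> srt (h u) = snd u"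
      and \<pi>: "emb t r G \<pi>" for p h G \<pi>
  proof -
    let ?G = "fst ` h ` free_vars p"
    have G: "?G \<subseteq> G" using h by force
    have "sat M (val \<rho> h) p \<longleftrightarrow> sat M (val \<pi> h) p" if \<rho>: "emb t r ?G \<rho>" for \<rho>
    proof -
      have sub: "tp L M {} (?G \<times> X) (\<lambda>(j, x). a (\<rho> j) x) \<subseteq> tp L M {} (?G \<times> X) (\<lambda>(j, x). a (\<pi> j) x)"
        by (rule indiscernible_emb[OF a t \<rho> emb_subset[OF \<pi> G]])
      have "h u \<in> ?G \<times> X \<and> (case h u of (j, x) \<Rightarrow> a (\<rho> j) x) \<in> sort_dom M (snd u)" if u: "u \<in> free_vars p" for u
      proof -
        have "h u \<in> ?G \<times> X" using h u by (simp add: mem_Times_iff)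
        moreover have "\<rho> (fst (h u)) \<in> Field r" using \<rho> u by (auto simp: emb_def)
        ultimately show ?thesis
          using srt_a[of "\<rho> (fst (h u))" "snd (h u)" "fst (h u)"] h u by (simp add: case_prod_unfold mem_Times_iff)
      qed
      from sat_of_tp_subset[OF sub p this] show ?thesis by (simp add: val_def case_prod_unfold)
    qed
    then show ?thesis using emb_subset[OF \<pi> G] unfolding Th_def by blast
  qed
  have fin: "fin_realized srt Th Y"
    unfolding fin_realized_def
  proof (intro conjI ballI allI impI)
    show "srt y \<in> sorts L" if "y \<in> Y" for y
      using srt_a[OF i0, of "snd y" "fst y"] that by (simp add: Y_def mem_Times_iff)
    fix F assume F: "finite F" "F \<subseteq> Y"
    then have "finite (fst ` F)" "fst ` F \<subseteq> Field t" by (auto simp: Y_def)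
    then obtain \<pi> where \<pi>: "emb t r (fst ` F) \<pi>" using emb_exists[OF t _ _ r] by blast
    let ?g = "\<lambda>y. a (\<pi> (fst y)) (snd y)"
    have "?g y \<in> sort_dom M (srt y)" if "y \<in> F" for y
    proof -
      have "\<pi> (fst y) \<in> Field r" "snd y \<in> X" using that F(2) \<pi> by (auto simp: emb_def Y_def)
      from srt_a[OF this, of "fst y"] show ?thesis by simp
    qed
    moreover have "Th p h \<longleftrightarrow> sat M (?g \<circ> h) p"
      if p: "p \<in> formulas L" and h: "\<forall>u\<in>free_vars p. h u \<in> F \<and> srt (h u) = snd u" for p h
    proof -
      have "\<forall>u\<in>free_vars p. h u \<in> fst ` F \<times> X \<and> srt (h u) = snd u"
        using h F(2) by (auto simp: Y_def mem_Times_iff)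
      from Th_iff[OF p this \<pi>] show ?thesis by (simp add: val_def comp_def)
    qed
    ultimately show "\<exists>g. (\<forall>y\<in>F. g y \<in> sort_dom M (srt y)) \<and>
        (\<forall>p\<in>formulas L. \<forall>h. (\<forall>u\<in>free_vars p. h u \<in> F \<and> srt (h u) = snd u) \<longrightarrow>
           (Th p h \<longleftrightarrow> sat M (g \<circ> h) p))"
      by (intro exI[of _ ?g]) simp
  qed
  have cardY: "|Y| <o \<kappa>"
    unfolding Y_def t_def Field_order_sum by (intro card_Times_less card_Un_less card_image_less small)
  define R0 where "R0 = (\<lambda>(i, x). ((Inl i :: 'i + 'i, x), a i x)) ` (Field r \<times> X)"
  have R0: "realizes srt Th R0"
    unfolding realizes_def
  proof (intro conjI ballI allI impI)
    fix z assume "z \<in> R0"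
    then show "case z of (y, x) \<Rightarrow> srt y \<in> sorts L \<and> x \<in> sort_dom M (srt y)"
      using srt_a by (auto simp: R0_def)
  next
    fix p h e assume p: "p \<in> formulas L" and he: "\<forall>u\<in>free_vars p. (h u, e u) \<in> R0 \<and> srt (h u) = snd u"
    have he': "h u \<in> Inl ` Field r \<times> X \<and> e u = val (case_sum id id) h u" if "u \<in> free_vars p" for u
      using he that by (auto simp: R0_def val_def)
    \<comment> \<open>Merging the two copies is not increasing on all of \<open>t\<close>, but it is
      on the left copy, where the labels of \<open>R0\<close> lie.\<close>
    have "emb t r (Inl ` Field r) (case_sum id id)"
      by (auto simp: emb_def t_def Field_order_sum)
    then have "Th p h \<longleftrightarrow> sat M (val (case_sum id id) h) p"
      using he he' by (intro Th_iff[OF p]) auto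
    also have "\<dots> \<longleftrightarrow> sat M e p" by (rule sat_cong) (simp add: he')
    finally show "Th p h \<longleftrightarrow> sat M e p" .
  qed
  have "|R0| <o \<kappa>" unfolding R0_def by (intro card_image_less card_Times_less small)
  moreover have "fst ` R0 \<subseteq> Y" by (auto simp: R0_def Y_def t_def Field_order_sum)
  ultimately obtain R where R: "R0 \<subseteq> R" "realizes srt Th R" "\<forall>y\<in>Y. \<exists>x. (y, x) \<in> R"
    using realize_all[OF fin cardY R0] by blast
  define b where "b j x = (SOME d. ((Inr j, x), d) \<in> R)" for j x
  define c where "c = case_sum a b"
  have c: "((j, x), c j x) \<in> R" if j: "j \<in> Field t" and x: "x \<in> X" for j x
  proof (cases j)
    case (Inl i)
    then have "i \<in> Field r" using j by (auto simp: t_def Field_order_sum)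
    then have "((Inl i, x), a i x) \<in> R0" using x unfolding R0_def by force
    then show ?thesis using R(1) Inl by (auto simp: c_def)
  next
    case (Inr i)
    have "\<exists>d. ((Inr i, x), d) \<in> R" using R(3) j x Inr by (simp add: Y_def)
    then show ?thesis unfolding Inr c_def b_def sum.case by (rule someI_ex)
  qed
  \<comment> \<open>Tuples of \<open>c\<close> are never compared directly: each is matched with a
    tuple of \<open>a\<close>, where indiscernibility is already known.\<close>
  have c_a: "tp L M {} (G \<times> X) (\<lambda>(j, x). c j x) = tp L M {} (G \<times> X) (\<lambda>(j, x). a (\<pi> j) x)"
    if \<pi>: "emb t r G \<pi>" for G \<pi>
  proof -
    have G: "j \<in> Field t" "\<pi> j \<in> Field r" if "j \<in> G" for j using \<pi> that by (auto simp: emb_def)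
    have srt: "(c j x \<in> sort_dom M s \<longleftrightarrow> srt (j, x) = s) \<and> (a (\<pi> j) x \<in> sort_dom M s \<longleftrightarrow> srt (j, x) = s)"
      if "j \<in> G" "x \<in> X" "s \<in> sorts L" for j x s
    proof -
      have "srt (j, x) \<in> sorts L" "a (\<pi> j) x \<in> sort_dom M (srt (j, x))"
        using srt_a[OF G(2)[OF that(1)] that(2)] by auto
      moreover have "c j x \<in> sort_dom M (srt (j, x))"
        using realizesD(2)[OF R(2) c[OF G(1)[OF that(1)] that(2)]] .
      ultimately show ?thesis using sort_unique[OF _ that(3)] by blast
    qed
    have "(p, h) \<in> tp L M {} (G \<times> X) (\<lambda>(j, x). c j x) \<longleftrightarrow> (p, h) \<in> tp L M {} (G \<times> X) (\<lambda>(j, x). a (\<pi> j) x)" for p h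
    proof (cases "p \<in> formulas L \<and> (\<forall>u\<in>free_vars p. h u \<in> G \<times> X <+> {} \<and> srt (projl (h u)) = snd u)")
      case True
      define l where "l u = projl (h u)" for u
      have l: "h u = Inl (l u)" "l u \<in> G \<times> X" "srt (l u) = snd u" if "u \<in> free_vars p" for u
        using True that by (auto simp: l_def)
      have "sat M (case_sum (\<lambda>(j, x). c j x) id \<circ> h) p \<longleftrightarrow> sat M (\<lambda>u. c (fst (l u)) (snd (l u))) p"
        by (rule sat_cong) (simp add: l(1) case_prod_unfold)
      also have "\<dots> \<longleftrightarrow> Th p l"
      proof (rule realizesD(4)[OF R(2), symmetric])
        fix u assume u: "u \<in> free_vars p"
        show "(l u, c (fst (l u)) (snd (l u))) \<in> R"
          using c[OF G(1), of "fst (l u)" "snd (l u)"] l(2)[OF u] by (simp add: mem_Times_iff)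
      qed (use True l in auto)
      also have "\<dots> \<longleftrightarrow> sat M (val \<pi> l) p"
        by (rule Th_iff[OF _ _ \<pi>]) (use True l in auto)
      also have "\<dots> \<longleftrightarrow> sat M (case_sum (\<lambda>(j, x). a (\<pi> j) x) id \<circ> h) p"
        by (rule sat_cong) (simp add: l(1) case_prod_unfold val_def)
      finally have sat: "sat M (case_sum (\<lambda>(j, x). c j x) id \<circ> h) p \<longleftrightarrow>
          sat M (case_sum (\<lambda>(j, x). a (\<pi> j) x) id \<circ> h) p" .
      have "c (fst (l u)) (snd (l u)) \<in> sort_dom M (snd u) \<and> a (\<pi> (fst (l u))) (snd (l u)) \<in> sort_dom M (snd u)"
        if u: "u \<in> free_vars p" for u
        using srt[of "fst (l u)" "snd (l u)" "snd u"] l(2,3)[OF u] free_var_sort[of p L u] True u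
        by (simp add: mem_Times_iff)
      then show ?thesis
        using True sat l(1) by (simp add: tp_def case_prod_unfold)
    next
      case False
      have "srt (projl (h u)) = snd u"
        if "p \<in> formulas L" "u \<in> free_vars p" "h u \<in> G \<times> X <+> {}"
          "case_sum (\<lambda>(j, x). c j x) id (h u) \<in> sort_dom M (snd u) \<or> case_sum (\<lambda>(j, x). a (\<pi> j) x) id (h u) \<in> sort_dom M (snd u)" for u
        using that srt free_var_sort[OF that(1,2)] by auto
      then show ?thesis using False unfolding tp_def by blast
    qed
    then show ?thesis by auto
  qed
  have "indiscernible_over L M X {} t c"
  proof (rule indiscernible_overI[OF t inft])
    show "c j x \<in> univ L M" if "j \<in> Field t" "x \<in> X" for j x
      using realizesD(3)[OF R(2) c[OF that]] .
    fix n \<pi> \<rho> assume emb: "emb natLeq t {..<n} \<pi>" "emb natLeq t {..<n} \<rho>"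
    have "\<exists>\<pi>'. emb natLeq r {..<n} \<pi>' \<and>
        tp L M {} ({..<n} \<times> X) (\<lambda>(k, x). c (\<pi> k) x) = tp L M {} ({..<n} \<times> X) (\<lambda>(k, x). a (\<pi>' k) x)"
      if \<pi>: "emb natLeq t {..<n} \<pi>" for \<pi>
    proof -
      have "\<pi> ` {..<n} \<subseteq> Field t" using \<pi> by (auto simp: emb_def)
      then obtain \<rho> where \<rho>: "emb t r (\<pi> ` {..<n}) \<rho>"
        using emb_exists[OF t _ _ r, of "\<pi> ` {..<n}"] by blast
      have "tp L M {} ({..<n} \<times> X) (\<lambda>(k, x). c (\<pi> k) x) = tp L M {} ({..<n} \<times> X) (\<lambda>(k, x). a (\<rho> (\<pi> k)) x)"
      proof (rule subset_antisym)
        show "tp L M {} ({..<n} \<times> X) (\<lambda>(k, x). c (\<pi> k) x) \<subseteq> tp L M {} ({..<n} \<times> X) (\<lambda>(k, x). a (\<rho> (\<pi> k)) x)"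
          by (rule tp_transfer[OF equalityD1[OF c_a[OF \<rho>]], of "\<lambda>(k, x). (\<pi> k, x)"]) auto
        show "tp L M {} ({..<n} \<times> X) (\<lambda>(k, x). a (\<rho> (\<pi> k)) x) \<subseteq> tp L M {} ({..<n} \<times> X) (\<lambda>(k, x). c (\<pi> k) x)"
          by (rule tp_transfer[OF equalityD2[OF c_a[OF \<rho>]], of "\<lambda>(k, x). (\<pi> k, x)"]) auto
      qed
      then show ?thesis using emb_comp[OF \<pi> \<rho>] by blast
    qed
    from this[OF emb(1)] this[OF emb(2)]
    show "tp L M {} ({..<n} \<times> X) (\<lambda>(k, x). c (\<pi> k) x) \<subseteq> tp L M {} ({..<n} \<times> X) (\<lambda>(k, x). c (\<rho> k) x)"
      using indiscernible_emb[OF a natLeq_Linear_order] by metis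
  qed
  then show ?thesis using that[of b] by (simp add: t_def c_def)
qed

section \<open>Kernel and canonical base\<close>

text \<open>The middle sequence \<open>b\<close> has the index order \<open>r\<close> itself, so it
  is small and indexed in \<open>'k\<close>, as the links of \<open>collinear\<close>
  require.\<close>

lemma collinear_of_continuations:
  assumes "indiscernible_over L M X {} (order_sum r r) (case_sum a b)"
    "indiscernible_over L M X {} (order_sum r r) (case_sum a' b)"
    and r: "Linear_order r" "infinite (Field r)" "|Field r| <o \<kappa>"
  shows "collinear \<kappa> L M X (r, a') (r, a)"
proof -
  let ?R = "\<lambda>A B. small \<kappa> (Field (fst A)) \<and> small \<kappa> (Field (fst B)) \<and> cleanly_collinear L M X A B"
  have "?R (r, a') (r, b)" "?R (r, b) (r, a)"
    using cleanly_collinearI[OF assms(1) r(1,2) r(1,2)] cleanly_collinearI[OF assms(2) r(1,2) r(1,2)] r(3)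
    by (simp_all add: small_def)
  then show ?thesis unfolding collinear_def by (rule tranclp.trancl_into_trancl[OF tranclp.r_into_trancl])
qed

text \<open>Common step for definability over \<open>a\<close> and for indiscernibility. The
  condition that \<open>\<sigma>(a)\<close> followed by \<open>b\<close> is indiscernible holds when
  \<open>\<sigma>\<close> fixes \<open>a\<close>, and also when it fixes \<open>b\<close>.\<close>

lemma canonical_base_fixed:
  assumes "canonical_base \<kappa> L M X r a B"
    and cont: "indiscernible_over L M X {} (order_sum r r) (case_sum a b)"
    and r: "Linear_order r" "infinite (Field r)" "|Field r| <o \<kappa>"
    and \<sigma>: "automorphism L M \<sigma>" "elementary (graph \<sigma>)"
    and cont': "indiscernible_over L M X {} (order_sum r r) (case_sum (\<lambda>i x. \<sigma> (a i x)) b)"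
    and "d \<in> B"
  shows "\<sigma> d = d"
  using collinear_of_continuations[OF cont cont' r] assms(1) \<sigma>(1) \<open>d \<in> B\<close>
  unfolding canonical_base_def by blast

lemma canonical_base_subset_ker:
  assumes a: "indiscernible_over L M X {} r a" and small: "|Field r| <o \<kappa>" "|X| <o \<kappa>"
    and base: "canonical_base \<kappa> L M X r a B"
  shows "B \<subseteq> ker L M X r a"
proof
  fix d assume d: "d \<in> B"
  have du: "d \<in> univ L M" using base d by (auto simp: canonical_base_def)
  have r: "Linear_order r" "infinite (Field r)" using indiscernible_overD[OF a] by auto
  have a_univ: "a i x \<in> univ L M" if "i \<in> Field r" "x \<in> X" for i x
    using indiscernible_overD(3)[OF a that] .
  obtain b where cont: "indiscernible_over L M X {} (order_sum r r) (case_sum a b)"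
    using continuation_exists[OF a small] .
  have b_univ: "b j x \<in> univ L M" if "j \<in> Field r" "x \<in> X" for j x
    using indiscernible_overD(3)[OF cont, of "Inr j" x] that by (simp add: Field_order_sum)
  have "d \<in> dcl L M (\<Union>i\<in>Field r. a i ` X)"
  proof (rule dclI[OF _ _ du])
    \<comment> \<open>\<open>\<kappa>\<close> may be singular, so the union is bounded as the image
      of a product.\<close>
    have eq: "(\<Union>i\<in>Field r. a i ` X) = (\<lambda>(i, x). a i x) ` (Field r \<times> X)" by auto
    show "(\<Union>i\<in>Field r. a i ` X) \<subseteq> univ L M" using a_univ by auto
    show "|\<Union>i\<in>Field r. a i ` X| <o \<kappa>"
      unfolding eq by (intro card_image_less card_Times_less small)
    fix \<sigma> assume \<sigma>: "automorphism L M \<sigma>" "elementary (graph \<sigma>)"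
      and fixed: "\<And>x. x \<in> (\<Union>i\<in>Field r. a i ` X) \<Longrightarrow> \<sigma> x = x"
    have "\<sigma> (a i x) = a i x" if "i \<in> Field r" "x \<in> X" for i x
      using fixed that by blast
    then have "indiscernible_over L M X {} (order_sum r r) (case_sum (\<lambda>i x. \<sigma> (a i x)) b)"
      by (intro indiscernible_cong[OF cont]) (auto simp: Field_order_sum)
    then show "\<sigma> d = d" by (rule canonical_base_fixed[OF base cont r small(1) \<sigma> _ d])
  qed
  moreover have "indiscernible_over L M X {d} r a"
  proof (rule indiscernible_overI[OF r a_univ])
    fix n \<pi> \<rho> assume emb: "emb natLeq r {..<n} \<pi>" "emb natLeq r {..<n} \<rho>"
    \<comment> \<open>The left part indexes the finite tuple that is to move from
      \<open>\<pi>\<close> to \<open>\<rho>\<close>, the right part all of \<open>b\<close>, which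
      is to stay fixed. Since \<open>b\<close> comes after \<open>a\<close>, both arrangements are
      embeddings into \<open>order_sum r r\<close>.\<close>
    let ?Y = "Inl ` {..<n} \<union> Inr ` Field r :: (nat + _) set"
    define val where "val \<pi> y = (case y of (j, x) \<Rightarrow> case_sum a b (map_sum \<pi> id j) x)"
      for \<pi> :: "nat \<Rightarrow> _" and y
    have sum_emb: "emb (order_sum natLeq r) (order_sum r r) ?Y (map_sum \<pi> id)" if "emb natLeq r {..<n} \<pi>" for \<pi>
      using emb_map_sum[OF that emb_id[OF subset_refl]] by (simp add: id_def)
    have "tp L M {} (?Y \<times> X) (val \<pi>) \<subseteq> tp L M {} (?Y \<times> X) (val \<rho>)"
      unfolding val_def
      by (rule indiscernible_emb[OF cont Linear_order_order_sum[OF natLeq_Linear_order r(1)]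
            sum_emb[OF emb(1)] sum_emb[OF emb(2)]])
    moreover have "val \<pi> y \<in> univ L M" if "y \<in> ?Y \<times> X" for y
      using that emb(1) a_univ b_univ by (auto simp: val_def emb_def)
    ultimately have el: "elementary ((\<lambda>y. (val \<pi> y, val \<rho> y)) ` (?Y \<times> X))"
      by (rule elementary_of_tp)
    have "|(\<lambda>y. (val \<pi> y, val \<rho> y)) ` (?Y \<times> X)| <o \<kappa>"
      by (intro card_image_less card_Times_less card_Un_less small card_finite_less finite_lessThan)
    then obtain \<sigma> where \<sigma>: "automorphism L M \<sigma>" "elementary (graph \<sigma>)"
      and ext: "\<And>x y. (x, y) \<in> (\<lambda>y. (val \<pi> y, val \<rho> y)) ` (?Y \<times> X) \<Longrightarrow> \<sigma> x = y"
      using automorphism_extends[OF el] by blast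
    have \<sigma>_val: "\<sigma> (val \<pi> y) = val \<rho> y" if "y \<in> ?Y \<times> X" for y
      by (rule ext) (use that in blast)
    have \<sigma>a: "\<sigma> (a (\<pi> k) x) = a (\<rho> k) x" if "k < n" "x \<in> X" for k x
      using \<sigma>_val[of "(Inl k, x)"] that by (simp add: val_def)
    have \<sigma>b: "\<sigma> (b j x) = b j x" if "j \<in> Field r" "x \<in> X" for j x
      using \<sigma>_val[of "(Inr j, x)"] that by (simp add: val_def)
    \<comment> \<open>As \<open>\<sigma>\<close> fixes \<open>b\<close>, this sequence is the image
      under \<open>\<sigma>\<close> of \<open>a\<close> followed by \<open>b\<close>.\<close>
    have "indiscernible_over L M X {} (order_sum r r) (case_sum (\<lambda>i x. \<sigma> (a i x)) b)"
      by (rule indiscernible_cong[OF indiscernible_elementary_map[OF \<sigma>(2) cont]])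
        (auto simp: Field_order_sum \<sigma>b)
    then have \<sigma>d: "\<sigma> d = d" by (rule canonical_base_fixed[OF base cont r small(1) \<sigma> _ d])
    show "tp L M {d} ({..<n} \<times> X) (\<lambda>(k, x). a (\<pi> k) x) \<subseteq> tp L M {d} ({..<n} \<times> X) (\<lambda>(k, x). a (\<rho> k) x)"
    proof
      fix z assume z: "z \<in> tp L M {d} ({..<n} \<times> X) (\<lambda>(k, x). a (\<pi> k) x)"
      obtain p h where ph: "z = (p, h)" by (rule prod.exhaust)
      let ?e = "case_sum (\<lambda>(k, x). a (\<pi> k) x) id \<circ> h" and ?e' = "case_sum (\<lambda>(k, x). a (\<rho> k) x) id \<circ> h"
      have p: "p \<in> formulas L" "sat M ?e p"
        and h: "\<And>u. u \<in> free_vars p \<Longrightarrow> h u \<in> ({..<n} \<times> X) <+> {d}"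
        and srt: "\<And>u. u \<in> free_vars p \<Longrightarrow> ?e u \<in> sort_dom M (snd u)"
        using z by (auto simp: ph tp_def)
      have e': "?e' u = \<sigma> (?e u)" if "u \<in> free_vars p" for u
        using h[OF that] \<sigma>a \<sigma>d by auto
      have "sat M (\<sigma> \<circ> ?e) p" using sat_elementary_map[OF \<sigma>(2) p(1) srt] p(2) by blast
      moreover have "sat M ?e' p \<longleftrightarrow> sat M (\<sigma> \<circ> ?e) p"
        by (rule sat_cong) (use e' in simp)
      moreover have "?e' u \<in> sort_dom M (snd u)" if "u \<in> free_vars p" for u
        unfolding e'[OF that] by (rule elementary_map_sort[OF \<sigma>(2) free_var_sort[OF p(1) that] srt[OF that]])
      ultimately show "z \<in> tp L M {d} ({..<n} \<times> X) (\<lambda>(k, x). a (\<rho> k) x)"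
        using p h by (simp add: ph tp_def)
    qed
  qed
  ultimately show "d \<in> ker L M X r a" by (simp add: ker_def)
qed

text \<open>The formula \<open>p\<close> defines \<open>d\<close> over every copy in the sequence \<open>(b\<^sub>j)\<close> of the
  finite tuple \<open>(a (ix u) (cx u))\<close>, where \<open>u\<close> ranges over the parameter variables of \<open>p\<close>.\<close>

definition defines_uniformly where
  "defines_uniformly r G v p ix cx d s b \<longleftrightarrow> (\<forall>\<rho>. emb r s G \<rho> \<longrightarrow>
     (\<forall>u\<in>free_vars p - {v}. b (\<rho> (ix u)) (cx u) \<in> sort_dom M (snd u)) \<and>
     solutions M v (p, \<lambda>u. b (\<rho> (ix u)) (cx u)) = {d})"

lemma solutions_cong:
  assumes "\<And>u. u \<in> free_vars p - {v} \<Longrightarrow> e u = e' u"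
  shows "solutions M v (p, e) = solutions M v (p, e')"
proof -
  have "sat M (e(v := c)) p \<longleftrightarrow> sat M (e'(v := c)) p" for c
    by (rule sat_cong) (use assms in \<open>simp add: fun_upd_def\<close>)
  then show ?thesis by (simp add: solutions_def)
qed

text \<open>One link of a chain of collinear sequences. \<open>r\<close> and \<open>G\<close> stay
  fixed along the chain and merely record the order type of the parameter tuple, while the sequences
  and their index orders change.\<close>

lemma defines_uniformly_cleanly_collinear:
  fixes r :: "'i rel" and cx :: "'s var \<Rightarrow> 'x"
  assumes r: "Linear_order r" "finite G" "G \<subseteq> Field r"
    and v: "snd v \<in> sorts L" and p: "p \<in> formulas L"
    and ix: "\<And>u. u \<in> free_vars p - {v} \<Longrightarrow> ix u \<in> G \<and> cx u \<in> X"
    and cc: "cleanly_collinear L M X (s, b) (t, c)"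
    and du: "defines_uniformly r G v p ix cx d s b"
  shows "defines_uniformly r G v p ix cx d t c"
  unfolding defines_uniformly_def
proof (intro allI impI)
  fix \<rho> assume \<rho>: "emb r t G \<rho>"
  have s: "Linear_order s" "infinite (Field s)" and t: "Linear_order t"
    using cc by (auto simp: cleanly_collinear_def dest: indiscernible_overD)
  \<comment> \<open>Two copies of \<open>G\<close>, one before the other, serve as the index set for
    a pair of parameter tuples.\<close>
  define o' where "o' = order_sum r r"
  have o': "Linear_order o'" unfolding o'_def by (rule Linear_order_order_sum[OF r(1) r(1)])
  let ?G = "Inl ` G \<union> Inr ` G :: ('i + 'i) set"
  have G: "finite ?G" "?G \<subseteq> Field o'" using r by (auto simp: o'_def Field_order_sum)
  obtain \<pi> where \<pi>: "emb o' s ?G \<pi>" using emb_exists[OF o' G s] .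
  have \<pi>l: "emb r s G (\<lambda>i. \<pi> (Inl i))" and \<pi>r: "emb r s G (\<lambda>i. \<pi> (Inr i))"
    using emb_comp[OF emb_Inl[OF r(3)] emb_subset[OF \<pi>[unfolded o'_def]]]
      emb_comp[OF emb_Inr[OF r(3)] emb_subset[OF \<pi>[unfolded o'_def]]] by auto
  text \<open>A tuple of \<open>b\<close> and the tuple of \<open>c\<close> along \<open>\<rho>\<close>, on either side of it, have the joint type of two
    tuples of \<open>b\<close>; as the latter give \<open>p\<close> the same solutions, so do the former.\<close>
  have same: "solutions M v (p, \<lambda>u. c (\<rho> (ix u)) (cx u)) = {d}
      \<and> (\<forall>u\<in>free_vars p - {v}. c (\<rho> (ix u)) (cx u) \<in> sort_dom M (snd u))"
    if sub: "tp L M {} (?G \<times> X) (\<lambda>(i, x). b (\<pi> i) x) \<subseteq> tp L M {} (?G \<times> X) f"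
      and k: "k = Inl \<and> k' = Inr \<or> k = Inr \<and> k' = Inl"
      and f: "\<And>i x. i \<in> G \<Longrightarrow> f (k i, x) = b (\<pi> (k i)) x" "\<And>i x. i \<in> G \<Longrightarrow> f (k' i, x) = c (\<rho> i) x"
    for f k k'
  proof -
    \<comment> \<open>\<open>k\<close> marks the copy of \<open>G\<close> that carries the tuple of
      \<open>b\<close>, and \<open>k'\<close> the copy that carries the tuple of \<open>c\<close>;
      the two cases are the two orders of concatenation.\<close>
    have kG: "k i \<in> ?G" "k' i \<in> ?G" if "i \<in> G" for i using k that by auto
    have emb_k: "emb r s G (\<lambda>i. \<pi> (k i))" "emb r s G (\<lambda>i. \<pi> (k' i))" using k \<pi>l \<pi>r by auto
    let ?l = "join_val v (\<lambda>u. (k (ix u), cx u)) (\<lambda>u. (k' (ix u), cx u))"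
    \<comment> \<open>The formula compares the solutions over the two tuples and does not mention
      \<open>d\<close>, so indiscernibility over the empty set is enough to transfer it.\<close>
    let ?q = "same_solutions v p p"
    have B: "b (\<pi> (k i)) (cx u) \<in> sort_dom M (snd u)" "b (\<pi> (k' i)) (cx u) \<in> sort_dom M (snd u)"
      if "u \<in> free_vars p - {v}" "i = ix u" for u i
      using du emb_k that unfolding defines_uniformly_def by blast+
    have solb: "solutions M v (p, \<lambda>u. b (\<pi> (k (ix u))) (cx u)) = {d}"
      "solutions M v (p, \<lambda>u. b (\<pi> (k' (ix u))) (cx u)) = {d}"
      using du emb_k unfolding defines_uniformly_def by blast+
    have c_srt: "c (\<rho> (ix u)) (cx u) \<in> sort_dom M (snd u)" if u: "u \<in> free_vars p - {v}" for u
    proof -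
      have "f (k' (ix u), cx u) \<in> sort_dom M (snd u)"
        by (rule tp_sort[OF sub]) (use u ix[OF u] kG(2) B(2)[OF u] free_var_sort[OF p] in auto)
      then show ?thesis using f(2) ix[OF u] by simp
    qed
    have solutions_iff: "sat M (join_val v e e') ?q \<longleftrightarrow> solutions M v (p, e) = solutions M v (p, e')" for e e'
      unfolding sat_same_solutions solutions_def by auto
    have "sat M (\<lambda>u. case ?l u of (i, x) \<Rightarrow> b (\<pi> i) x) ?q \<longleftrightarrow> sat M (\<lambda>u. f (?l u)) ?q"
    proof (rule sat_of_tp_subset[OF sub])
      show "?q \<in> formulas L" using p v by (simp add: apart_formulas)
      fix u assume u: "u \<in> free_vars ?q"
      then consider w where "w \<in> free_vars p - {v}" "u = apart v 0 w"
        | w where "w \<in> free_vars p - {v}" "u = apart v (Suc 0) w"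
        unfolding free_vars_apart by blast
      then show "?l u \<in> ?G \<times> X \<and> (case ?l u of (i, x) \<Rightarrow> b (\<pi> i) x) \<in> sort_dom M (snd u)"
      proof cases
        case (1 w)
        then show ?thesis using ix[OF 1(1)] kG(1) B(1)[OF 1(1) refl] by (simp add: join_val_apart)
      next
        case (2 w)
        then show ?thesis using ix[OF 2(1)] kG(2) B(2)[OF 2(1) refl] by (simp add: join_val_apart)
      qed
    qed
    moreover have "(\<lambda>u. case ?l u of (i, x) \<Rightarrow> b (\<pi> i) x) =
        join_val v (\<lambda>u. b (\<pi> (k (ix u))) (cx u)) (\<lambda>u. b (\<pi> (k' (ix u))) (cx u))"
      using comp_join_val[of "\<lambda>(i, x). b (\<pi> i) x" v "\<lambda>u. (k (ix u), cx u)" "\<lambda>u. (k' (ix u), cx u)"]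
      by (simp add: comp_def)
    moreover have "(\<lambda>u. f (?l u)) = join_val v (\<lambda>u. f (k (ix u), cx u)) (\<lambda>u. f (k' (ix u), cx u))"
      using comp_join_val[of f v "\<lambda>u. (k (ix u), cx u)" "\<lambda>u. (k' (ix u), cx u)"] by (simp add: comp_def)
    ultimately have "solutions M v (p, \<lambda>u. f (k (ix u), cx u)) = solutions M v (p, \<lambda>u. f (k' (ix u), cx u))"
      using solb by (simp only: solutions_iff simp_thms)
    moreover have "solutions M v (p, \<lambda>u. f (k (ix u), cx u)) = solutions M v (p, \<lambda>u. b (\<pi> (k (ix u))) (cx u))"
      by (rule solutions_cong) (use f ix in auto)
    moreover have "solutions M v (p, \<lambda>u. f (k' (ix u), cx u)) = solutions M v (p, \<lambda>u. c (\<rho> (ix u)) (cx u))"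
      by (rule solutions_cong) (use f ix in auto)
    ultimately show ?thesis using solb c_srt by simp
  qed
  from cc consider "indiscernible_over L M X {} (order_sum s t) (case_sum b c)"
    | "indiscernible_over L M X {} (order_sum t s) (case_sum c b)"
    by (auto simp: cleanly_collinear_def)
  then show "(\<forall>u\<in>free_vars p - {v}. c (\<rho> (ix u)) (cx u) \<in> sort_dom M (snd u)) \<and>
     solutions M v (p, \<lambda>u. c (\<rho> (ix u)) (cx u)) = {d}"
  proof cases
    case 1
    have "emb o' (order_sum s t) ?G (\<lambda>i. Inl (\<pi> i))"
      by (rule emb_comp_Field[OF \<pi> emb_Inl[OF subset_refl]])
    moreover have "emb o' (order_sum s t) ?G (map_sum (\<lambda>i. \<pi> (Inl i)) \<rho>)"
      unfolding o'_def by (rule emb_map_sum[OF \<pi>l \<rho>])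
    ultimately have "tp L M {} (?G \<times> X) (\<lambda>(i, x). case_sum b c (Inl (\<pi> i)) x) \<subseteq>
        tp L M {} (?G \<times> X) (\<lambda>(i, x). case_sum b c (map_sum (\<lambda>i. \<pi> (Inl i)) \<rho> i) x)"
      by (rule indiscernible_emb[OF 1 o'])
    then show ?thesis
      using same[of "\<lambda>(i, x). case_sum b c (map_sum (\<lambda>i. \<pi> (Inl i)) \<rho> i) x" Inl Inr] by simp
  next
    case 2
    have "emb o' (order_sum t s) ?G (\<lambda>i. Inr (\<pi> i))"
      by (rule emb_comp_Field[OF \<pi> emb_Inr[OF subset_refl]])
    moreover have "emb o' (order_sum t s) ?G (map_sum \<rho> (\<lambda>i. \<pi> (Inr i)))"
      unfolding o'_def by (rule emb_map_sum[OF \<rho> \<pi>r])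
    ultimately have "tp L M {} (?G \<times> X) (\<lambda>(i, x). case_sum c b (Inr (\<pi> i)) x) \<subseteq>
        tp L M {} (?G \<times> X) (\<lambda>(i, x). case_sum c b (map_sum \<rho> (\<lambda>i. \<pi> (Inr i)) i) x)"
      by (rule indiscernible_emb[OF 2 o'])
    then show ?thesis
      using same[of "\<lambda>(i, x). case_sum c b (map_sum \<rho> (\<lambda>i. \<pi> (Inr i)) i) x" Inr Inl] by simp
  qed
qed

text \<open>That \<open>p\<close> defines \<open>d\<close> over a tuple is itself a formula about
  the tuple with parameter \<open>d\<close>. Indiscernibility over \<open>d\<close> carries it from
  the tuple given by \<open>dcl\<close> to every tuple of the same order type.\<close>

lemma ker_defines_uniformly:
  assumes a: "indiscernible_over L M X {d} r a" and d: "d \<in> dcl L M (\<Union>i\<in>Field r. a i ` X)"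
  shows "\<exists>G v p ix cx. finite G \<and> G \<subseteq> Field r \<and> snd v \<in> sorts L \<and> p \<in> formulas L \<and>
    (\<forall>u\<in>free_vars p - {v}. ix u \<in> G \<and> cx u \<in> X) \<and> defines_uniformly r G v p ix cx d r a"
proof -
  obtain v p e where v: "snd v \<in> sorts L" and p: "p \<in> formulas L"
    and e: "\<And>u. u \<in> free_vars p - {v} \<Longrightarrow> e u \<in> (\<Union>i\<in>Field r. a i ` X) \<inter> sort_dom M (snd u)"
    and sol: "solutions M v (p, e) = {d}"
    using d unfolding dcl_def param_formulas_def by blast
  have "\<forall>u\<in>free_vars p - {v}. \<exists>i x. i \<in> Field r \<and> x \<in> X \<and> e u = a i x"
    using e by blast
  then obtain ix cx where ix: "\<And>u. u \<in> free_vars p - {v} \<Longrightarrow> ix u \<in> Field r \<and> cx u \<in> X \<and> e u = a (ix u) (cx u)"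
    by metis
  define G where "G = ix ` (free_vars p - {v})"
  have G: "finite G" "G \<subseteq> Field r" using ix finite_free_vars[of p] by (auto simp: G_def)
  have r: "Linear_order r" using indiscernible_overD[OF a] by simp
  have dv: "d \<in> sort_dom M (snd v)" using sol by (auto simp: solutions_def)
  \<comment> \<open>A second variable of the sort of \<open>v\<close>, whose value will be
    \<open>d\<close>.\<close>
  define w where "w = (Suc (fst v), snd v)"
  have vw: "w \<noteq> v" by (cases v) (simp add: w_def)
  \<comment> \<open>Says that the solutions of \<open>p\<close> are exactly the element
    \<open>d\<close>, by comparison with the formula \<open>v = w\<close>.\<close>
  let ?q = "same_solutions v p (Equal (Var v) (Var w))"
  have q: "?q \<in> formulas L" using p v by (simp add: apart_formulas ren_formulas w_def)
  have "defines_uniformly r G v p ix cx d r a"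
    unfolding defines_uniformly_def
  proof (intro allI impI)
    fix \<rho> assume \<rho>: "emb r r G \<rho>"
    have sub: "tp L M {d} (G \<times> X) (\<lambda>(i, x). a i x) \<subseteq> tp L M {d} (G \<times> X) (\<lambda>(i, x). a (\<rho> i) x)"
      by (rule indiscernible_emb[OF a r emb_id[OF G(2)] \<rho>])
    define h where "h = join_val v (\<lambda>u. Inl (ix u, cx u)) (\<lambda>_. Inr d)"
    have val: "case_sum (\<lambda>(i, x). f i x) id \<circ> h = join_val v (\<lambda>u. f (ix u) (cx u)) (\<lambda>_. d)" for f
      unfolding h_def comp_join_val by (simp add: comp_def)
    have sat_q: "sat M (join_val v e' (\<lambda>_. d)) ?q \<longleftrightarrow> solutions M v (p, e') = {d}" for e'
      unfolding sat_same_solutions solutions_def using vw dv by auto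
    have fv: "free_vars ?q = apart v 0 ` (free_vars p - {v}) \<union> {apart v (Suc 0) w}"
      unfolding free_vars_apart using vw by auto
    have "solutions M v (p, \<lambda>u. a (ix u) (cx u)) = solutions M v (p, e)"
      by (rule solutions_cong) (use ix in auto)
    then have "sat M (case_sum (\<lambda>(i, x). a i x) id \<circ> h) ?q"
      unfolding val sat_q using sol by simp
    moreover have "h u \<in> G \<times> X <+> {d} \<and> (case_sum (\<lambda>(i, x). a i x) id \<circ> h) u \<in> sort_dom M (snd u)"
      if u: "u \<in> free_vars ?q" for u
    proof -
      from u consider y where "y \<in> free_vars p - {v}" "u = apart v 0 y" | "u = apart v (Suc 0) w"
        unfolding fv by blast
      then show ?thesis
      proof cases
        case (1 y)
        then show ?thesis
          using ix[OF 1(1)] e[OF 1(1)] unfolding val by (auto simp: h_def join_val_apart G_def)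
      next
        case 2
        then show ?thesis
          using dv vw unfolding val by (auto simp: h_def join_val_apart w_def)
      qed
    qed
    ultimately have "(?q, h) \<in> tp L M {d} (G \<times> X) (\<lambda>(i, x). a i x)"
      using q by (simp only: tp_def mem_Collect_eq prod.case o_apply) blast
    then have "(?q, h) \<in> tp L M {d} (G \<times> X) (\<lambda>(i, x). a (\<rho> i) x)" using sub by blast
    then have *: "sat M (case_sum (\<lambda>(i, x). a (\<rho> i) x) id \<circ> h) ?q"
      "\<forall>u\<in>free_vars ?q. (case_sum (\<lambda>(i, x). a (\<rho> i) x) id \<circ> h) u \<in> sort_dom M (snd u)"
      by (simp_all only: tp_def mem_Collect_eq prod.case o_apply) blast
    have "a (\<rho> (ix u)) (cx u) \<in> sort_dom M (snd u)" if u: "u \<in> free_vars p - {v}" for u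
      using bspec[OF *(2), of "apart v 0 u"] u unfolding fv val by (simp add: join_val_apart)
    then show "(\<forall>u\<in>free_vars p - {v}. a (\<rho> (ix u)) (cx u) \<in> sort_dom M (snd u)) \<and>
        solutions M v (p, \<lambda>u. a (\<rho> (ix u)) (cx u)) = {d}"
      using *(1) unfolding val sat_q by simp
  qed
  moreover have "\<forall>u\<in>free_vars p - {v}. ix u \<in> G \<and> cx u \<in> X"
    using ix unfolding G_def by blast
  ultimately show ?thesis using G v p by blast
qed

lemma ker_fixed:
  assumes a: "indiscernible_over L M X {} r a" and d: "d \<in> ker L M X r a"
    and aut: "automorphism L M \<sigma>" and \<sigma>: "elementary (graph \<sigma>)" and col: "collinear \<kappa> L M X (r, \<lambda>i x. \<sigma> (a i x)) (r, a)"
  shows "\<sigma> d = d"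
proof -
  have r: "Linear_order r" using indiscernible_overD[OF a] by simp
  have "indiscernible_over L M X {d} r a" "d \<in> dcl L M (\<Union>i\<in>Field r. a i ` X)"
    using d by (simp_all add: ker_def)
  from ker_defines_uniformly[OF this]
  obtain G v p ix cx where G: "finite G" "G \<subseteq> Field r" and v: "snd v \<in> sorts L" and p: "p \<in> formulas L"
    and ix: "\<forall>u\<in>free_vars p - {v}. ix u \<in> G \<and> cx u \<in> X" and du: "defines_uniformly r G v p ix cx d r a"
    by (elim exE conjE)
  have "defines_uniformly r G v p ix cx (\<sigma> d) r (\<lambda>i x. \<sigma> (a i x))"
    unfolding defines_uniformly_def
  proof (intro allI impI)
    fix \<rho> assume "emb r r G \<rho>"
    then have *: "\<forall>u\<in>free_vars p - {v}. a (\<rho> (ix u)) (cx u) \<in> sort_dom M (snd u)"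
      and sol: "solutions M v (p, \<lambda>u. a (\<rho> (ix u)) (cx u)) = {d}"
      using du unfolding defines_uniformly_def by blast+
    let ?e = "\<lambda>u. a (\<rho> (ix u)) (cx u)"
    have sat: "sat M ((\<lambda>u. \<sigma> (?e u))(v := \<sigma> c)) p \<longleftrightarrow> sat M (?e(v := c)) p" if c: "c \<in> sort_dom M (snd v)" for c
    proof -
      have "(\<lambda>u. \<sigma> (?e u))(v := \<sigma> c) = \<sigma> \<circ> (?e(v := c))" by (auto simp: fun_eq_iff)
      moreover have "sat M (\<sigma> \<circ> (?e(v := c))) p \<longleftrightarrow> sat M (?e(v := c)) p"
        by (rule sat_elementary_map[OF \<sigma> p]) (use * c in \<open>auto simp: fun_upd_def\<close>)
      ultimately show ?thesis by simp
    qed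
    \<comment> \<open>Elementarity only shows that \<open>\<sigma>\<close> maps solutions to
      solutions; that every solution over the image tuple arises in this way needs surjectivity on
      the sort.\<close>
    have surj: "\<exists>c\<in>sort_dom M (snd v). y = \<sigma> c" if "y \<in> sort_dom M (snd v)" for y
      using aut v that unfolding automorphism_def bij_betw_def by blast
    have "solutions M v (p, \<lambda>u. \<sigma> (?e u)) = \<sigma> ` solutions M v (p, ?e)"
    proof (rule set_eqI)
      fix y
      show "y \<in> solutions M v (p, \<lambda>u. \<sigma> (?e u)) \<longleftrightarrow> y \<in> \<sigma> ` solutions M v (p, ?e)"
        using surj[of y] sat elementary_map_sort[OF \<sigma> v] unfolding solutions_def by fastforce
    qed
    then show "(\<forall>u\<in>free_vars p - {v}. \<sigma> (?e u) \<in> sort_dom M (snd u)) \<and> solutions M v (p, \<lambda>u. \<sigma> (?e u)) = {\<sigma> d}"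
      using sol * elementary_map_sort[OF \<sigma> free_var_sort[OF p]] by simp
  qed
  moreover have "defines_uniformly r G v p ix cx (\<sigma> d) (fst A) (snd A) \<longrightarrow> defines_uniformly r G v p ix cx (\<sigma> d) (fst C) (snd C)"
    if "collinear \<kappa> L M X A C" for A C
    using that unfolding collinear_def
  proof (induction rule: tranclp_induct)
    case (base C)
    then have "cleanly_collinear L M X (fst A, snd A) (fst C, snd C)" by simp
    from defines_uniformly_cleanly_collinear[OF r G v p _ this] show ?case using ix by blast
  next
    case (step C D)
    then have "cleanly_collinear L M X (fst C, snd C) (fst D, snd D)" by simp
    from defines_uniformly_cleanly_collinear[OF r G v p _ this] show ?case using ix step.IH by blast
  qed
  ultimately have "defines_uniformly r G v p ix cx (\<sigma> d) r a"
    using col by fastforce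
  then have "{d} = {\<sigma> d}"
    using du emb_id[OF G(2)] unfolding defines_uniformly_def by metis
  then show ?thesis by simp
qed

text \<open>One inclusion is monotonicity of \<open>dcl\<close>. For the other, \<open>dclI\<close>
  is applied to \<open>B\<close>, whose smallness is part of \<open>canonical_base\<close>; the
  kernel enters as a set fixed pointwise by every elementary automorphism over
  \<open>B\<close>.\<close>

lemma dcl_canonical_base:
  assumes a: "indiscernible_over L M X {} r a" and small: "|Field r| <o \<kappa>" "|X| <o \<kappa>"
    and base: "canonical_base \<kappa> L M X r a B"
  shows "dcl L M B = dcl L M (ker L M X r a)"
proof
  show "dcl L M B \<subseteq> dcl L M (ker L M X r a)"
    using canonical_base_subset_ker[OF assms] unfolding dcl_def param_formulas_def by blast
  show "dcl L M (ker L M X r a) \<subseteq> dcl L M B"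
  proof
    fix d assume d: "d \<in> dcl L M (ker L M X r a)"
    show "d \<in> dcl L M B"
    proof (rule dclI)
      show "B \<subseteq> univ L M" "|B| <o \<kappa>" using base by (auto simp: canonical_base_def small_def)
      obtain v pe where "snd v \<in> sorts L" "solutions M v pe = {d}" using d by (auto simp: dcl_def)
      then show "d \<in> univ L M" by (cases pe) (auto simp: solutions_def univ_def)
      fix \<sigma> assume \<sigma>: "automorphism L M \<sigma>" "elementary (graph \<sigma>)" and fixed: "\<And>x. x \<in> B \<Longrightarrow> \<sigma> x = x"
      have "collinear \<kappa> L M X (r, \<lambda>i x. \<sigma> (a i x)) (r, a)"
        using base \<sigma>(1) fixed unfolding canonical_base_def by blast
      then show "\<sigma> d = d"
        using ker_fixed[OF a _ \<sigma>] by (intro elementary_map_fixes_dcl[OF \<sigma>(2) _ d]) blast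
    qed
  qed
qed

end

theorem corollary3p15:
  fixes L :: "('s, 'f, 'r) signature"
    and T :: "('s, 'f, 'r) fm set"
    and M :: "('s, 'f, 'r, 'a) struct"
    and \<kappa> :: "'k rel"
    and X :: "'x set"
    and r :: "'k rel"
    and a :: "'k \<Rightarrow> 'x \<Rightarrow> 'a"
    and B :: "'a set"
  assumes "wf_signature L"
    and "consistent_theory TYPE('k) L T"
    and "complete_theory TYPE('k) L T"
    and "M \<in> models L T"
    and "big_saturated_model \<kappa> L M"
    and "small \<kappa> X"
    and "small \<kappa> (Field r)"
    and "indiscernible_over L M X {} r a"
    and "canonical_base \<kappa> L M X r a B"
  shows "dcl L M B = dcl L M (ker L M X r a)"
proof -
  have card: "Card_order \<kappa>" using assms(5) by (simp add: big_saturated_model_def)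
  \<comment> \<open>\<open>\<kappa>\<close> is infinite because it bounds the size of an infinite
    index set.\<close>
  have "infinite (Field r)" using assms(8) by (rule indiscernible_overD)
  moreover have "|Field r| \<le>o |Field \<kappa>|"
    using ordLess_imp_ordLeq[OF assms(7)[unfolded small_def]] card_of_Field_ordIso[OF card]
    by (meson ordIso_symmetric ordLeq_ordIso_trans)
  ultimately have "infinite (Field \<kappa>)" using card_of_ordLeq_finite by blast
  then interpret big_model L M \<kappa>
    using assms(1,5) by unfold_locales
  show ?thesis
    using dcl_canonical_base assms(6-9) by (simp add: small_def)
qed

end
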